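(* Let $(M,d)$ be a metric space and let $Y$ be a bounded subset of $M$. Let $\mathcal{N}$ be a $\sigma$-algebra of subsets of $Y$ containing all Borel subsets of $Y$, and let $\nu$ be a measure on $\mathcal{N}$ such that $\nu(B(x,r)\cap Y)<+\infty$ for all $x\in Y$, $r>0$. Let $\upsilon_Y\in]0,+\infty[$ and assume that $Y$ is upper $\upsilon_Y$-Ahlfors regular with respect to $Y$. Let $\theta\in]0,1]$, $s_1\in[0,\upsilon_Y[\cap[\upsilon_Y-1,\upsilon_Y[$, $s_2\in[0,+\infty[$, $s_3\in]0,1]$. If $s_2=\upsilon_Y$, assume furthermore that $Y$ is strongly upper $\upsilon_Y$-Ahlfors regular with respect to $Y$; if $s_2>\upsilon_Y$, assume furthermore that $s_2<\upsilon_Y+s_3$. Let $\varpi:[0,+\infty[\to[0,+\infty[$ be defined by $\varpi(0)\equiv0$ and, for $r>0$, \[ \varpi(r)\equiv\begin{cases} r^{\min\{\upsilon_Y-s_1,s_3\}} &\text{if } s_2<\upsilon_Y,\\ \max\{r^{\upsilon_Y-s_1},\omega_{s_3}(r)\}&\text{if } s_2=\upsilon_Y,\\ r^{\min\{\upsilon_Y-s_1,\,s_3+\upsilon_Y-s_2\}}&\text{if } s_2>\upsilon_Y.\end{cases} \] Let $K\in\mathcal{K}_{s_1,s_2,s_3}(Y\times Y)$ and let $A[K,\mu](x)\equiv\int_Y K(x,y)\mu(y)\,d\nu(y)$, $x\in Y$, for $\mu\in L^2_\nu(Y)$. If $g\in C^{0,\theta}_b(Y)$ and $\mu\in L^2_\nu(Y)$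 satisfies $\mu-A[K,\mu]=g$ $\nu$-a.e. in $Y$, then $\mu\in C^{0,\max\{r^\theta,\varpi(r)\}}_b(Y)$.
   Context: For $\xi\in M$, $r>0$, $B(\xi,r)=\{\eta\in M: d(\xi,\eta)<r\}$, and $B(\xi,0)=\emptyset$. $Y$ is upper $\upsilon$-Ahlfors regular with respect to $Y$ if there exist $r_0\in]0,+\infty]$, $c_0\in]0,+\infty[$ with $\nu(B(x,r)\cap Y)\leq c_0r^{\upsilon}$ for all $x\in Y$, $r\in]0,r_0[$; strongly upper $\upsilon$-Ahlfors regular with respect to $Y$ if there exist $r_0\in]0,+\infty]$, $c_0\in]0,+\infty[$ with $\nu((B(x,r_2)\setminus B(x,r_1))\cap Y)\leq c_0(r_2^{\upsilon}-r_1^{\upsilon})$ for all $x\in Y$, $r_1,r_2\in[0,r_0[$, $r_1<r_2$. For $a_1,a_2,a_3\in\mathbb{R}$, $\mathcal{K}_{a_1,a_2,a_3}(Y\times Y)$ is the set of continuous $K:\{(x,y)\in Y^2:x\neq y\}\to\mathbb{C}$ such that $\sup\{d(x,y)^{a_1}|K(x,y)|: x\neq y\}<+\infty$ and $\sup\{\frac{d(x',y)^{a_2}}{d(x',x'')^{a_3}}|K(x',y)-K(x'',y)|: x',x''\in Y, x'\neq x'', y\in Y\setminus B(x',2d(x',x''))\}<+\infty$. For $\theta\in]0,1]$, $\omega_\theta(0)=0$, $\omega_\theta(r)=r^\theta|\ln r|$ for $r\in]0,e^{-1/\theta}]$, $\omega_\theta(r)=e^{-1}\cdot\frac{1}{\theta}$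 (i.e. $r_\theta^\theta|\ln r_\theta|$ with $r_\theta=e^{-1/\theta}$) for $r>e^{-1/\theta}$. For a function $\omega:[0,+\infty[\to[0,+\infty[$, $C^{0,\omega(\cdot)}_b(Y)$ is the set of bounded continuous $f:Y\to\mathbb{C}$ with $\sup\{|f(x)-f(y)|/\omega(d(x,y)): x,y\in Y,x\neq y\}<+\infty$; $C^{0,\theta}_b(Y)$ denotes the case $\omega(r)=r^\theta$. Membership of $\mu\in L^2_\nu(Y)$ in such a space means $\mu$ has a representative in it. *)

theory Defs
  imports "HOL-Analysis.Analysis"
begin

definition upper_ahlfors_regular :: "'a::metric_space measure \<Rightarrow> 'a set \<Rightarrow> real \<Rightarrow> bool" where
  "upper_ahlfors_regular nu Y ups \<longleftrightarrow>
     (\<exists>r0::ereal. \<exists>c0::real. 0 < r0 \<and> 0 < c0 \<and>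
        (\<forall>x\<in>Y. \<forall>r::real. 0 < r \<and> ereal r < r0 \<longrightarrow>
           emeasure nu (ball x r \<inter> Y) \<le> ennreal (c0 * r powr ups)))"

definition strongly_upper_ahlfors_regular :: "'a::metric_space measure \<Rightarrow> 'a set \<Rightarrow> real \<Rightarrow> bool" where
  "strongly_upper_ahlfors_regular nu Y ups \<longleftrightarrow>
     (\<exists>r0::ereal. \<exists>c0::real. 0 < r0 \<and> 0 < c0 \<and>
        (\<forall>x\<in>Y. \<forall>r1 r2::real. 0 \<le> r1 \<and> 0 \<le> r2 \<and> ereal r1 < r0 \<and> ereal r2 < r0 \<and> r1 < r2 \<longrightarrow>
           emeasure nu ((ball x r2 - ball x r1) \<inter> Y) \<le> ennreal (c0 * (r2 powr ups - r1 powr ups))))"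

definition kernel_class :: "real \<Rightarrow> real \<Rightarrow> real \<Rightarrow> 'a::metric_space set \<Rightarrow> ('a \<Rightarrow> 'a \<Rightarrow> complex) \<Rightarrow> bool" where
  "kernel_class a1 a2 a3 Y K \<longleftrightarrow>
     continuous_on {(x, y). x \<in> Y \<and> y \<in> Y \<and> x \<noteq> y} (\<lambda>(x, y). K x y) \<and>
     (\<exists>C1. \<forall>x\<in>Y. \<forall>y\<in>Y. x \<noteq> y \<longrightarrow> dist x y powr a1 * cmod (K x y) \<le> C1) \<and>
     (\<exists>C2. \<forall>x'\<in>Y. \<forall>x''\<in>Y. \<forall>y\<in>Y - ball x' (2 * dist x' x''). x' \<noteq> x'' \<longrightarrow>
        dist x' y powr a2 / dist x' x'' powr a3 * cmod (K x' y - K x'' y) \<le> C2)"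

definition omega_log :: "real \<Rightarrow> real \<Rightarrow> real" where
  "omega_log \<theta> r =
     (if r = 0 then 0
      else if r \<le> exp (- 1 / \<theta>) then r powr \<theta> * \<bar>ln r\<bar>
      else exp (- 1) * (1 / \<theta>))"

definition holder_space :: "(real \<Rightarrow> real) \<Rightarrow> 'a::metric_space set \<Rightarrow> ('a \<Rightarrow> complex) \<Rightarrow> bool" where
  "holder_space \<omega> Y f \<longleftrightarrow>
     bounded (f ` Y) \<and> continuous_on Y f \<and>
     (\<exists>C. \<forall>x\<in>Y. \<forall>y\<in>Y. x \<noteq> y \<longrightarrow> cmod (f x - f y) / \<omega> (dist x y) \<le> C)"

definition varpi :: "real \<Rightarrow> real \<Rightarrow> real \<Rightarrow> real \<Rightarrow> real \<Rightarrow> real" where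
  "varpi ups s1 s2 s3 r =
     (if r = 0 then 0
      else if s2 < ups then r powr (min (ups - s1) s3)
      else if s2 = ups then max (r powr (ups - s1)) (omega_log s3 r)
      else r powr (min (ups - s1) (s3 + ups - s2)))"

definition layer_op :: "'a measure \<Rightarrow> ('a \<Rightarrow> 'a \<Rightarrow> complex) \<Rightarrow> ('a \<Rightarrow> complex) \<Rightarrow> 'a \<Rightarrow> complex" where
  "layer_op nu K \<mu> x = (\<integral>y. K x y * \<mu> y \<partial>nu)"

end

theory Submission
  imports Defs
begin

text \<open>
  Write \<open>P\<^sub>e f(x)\<close> for the integral of \<open>d(x,y)\<close> to the power \<open>-s\<^sub>1\<close> times \<open>f(y)\<close> over the ball
  \<open>B(x,e)\<close>. Dyadic decomposition bounds \<open>P\<^sub>e\<close> by a multiple of \<open>e\<close> to the power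
  \<open>\<upsilon> - s\<^sub>1\<close>, both on bounded functions and, up to a measurable majorant, on integrable ones.
  A solution satisfies \<open>|\<mu>| \<le> G + C\<^sub>1 P\<^sub>e |\<mu>|\<close> for a constant \<open>G\<close> depending on \<open>e\<close>, so for
  small \<open>e\<close> the function \<open>(|\<mu>| - 2G)\<^sup>+\<close> is at most \<open>C\<^sub>1 P\<^sub>e\<close> of itself and has integral
  zero: \<open>\<mu>\<close> is bounded. Then \<open>g + A[K,\<mu>]\<close> is a representative, and its modulus
  of continuity at \<open>x', x''\<close> follows by splitting the integral at distance \<open>2 d(x',x'')\<close> from \<open>x'\<close>.
\<close>

section \<open>A Vitali-type selection\<close>

text \<open>The boundedness step works in L^1: \<open>Y\<close> has finite mass, so a square
  integrable density is integrable. One needs the integral of a potential to be at most a small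
  multiple of the integral of the function. Ordinarily this is symmetry of \<open>dist\<close> plus
  Tonelli; here even the potential of a measurable function is not known to be measurable, so the
  estimate is made for a measurable \<open>H\<close> above it. \<open>H\<close> is a sum over
  separated centres chosen in Vitali's manner: the small balls around the centres are disjoint, so
  the values at the centres add up to at most the integral, and the doubled balls pass these values
  on to all other points. The three cases of \<open>varpi\<close> mirror the integral of
  \<open>dist x y powr - s2\<close> outside a ball of radius \<open>2 * dist x z\<close>: it stays
  bounded for \<open>s2 < ups\<close>, grows logarithmically for \<open>s2 = ups\<close>, and grows
  like a negative power of the radius for \<open>s2 > ups\<close>. The factor
  \<open>dist x z powr s3\<close> from the kernel condition then multiplies it.\<close>

lemma maximal_separated_superset:
  fixes A S :: "'a::metric_space set"
  assumes "S \<subseteq> A" "pairwise (\<lambda>x y. t \<le> dist x y) S" "0 < t"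
  obtains S' where "S \<subseteq> S'" "S' \<subseteq> A" "pairwise (\<lambda>x y. t \<le> dist x y) S'"
    "\<And>y. y \<in> A \<Longrightarrow> \<exists>x\<in>S'. dist x y < t"
proof -
  \<comment> \<open>The prescribed \<open>S\<close> stays inside every competitor, so that nets of
    successive levels can later be nested.\<close>
  define F where "F = {X. S \<subseteq> X \<and> X \<subseteq> A \<and> pairwise (\<lambda>x y. t \<le> dist x y) X}"
  have "\<exists>M\<in>F. \<forall>X\<in>F. M \<subseteq> X \<longrightarrow> X = M"
  proof (rule subset_Zorn_nonempty)
    show "F \<noteq> {}" using assms by (auto simp: F_def)
    fix C assume C: "C \<noteq> {}" "subset.chain F C"
    then have "chain\<^sub>\<subseteq> C" by (auto simp: subset_chain_def chain_subset_def)
    with C have "pairwise (\<lambda>x y. t \<le> dist x y) (\<Union>C)"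
      by (intro pairwise_chain_Union) (auto simp: subset_chain_def F_def)
    then show "\<Union>C \<in> F"
      using C by (auto simp: F_def subset_chain_def)
  qed
  then obtain M where M: "M \<in> F" and max: "\<And>X. X \<in> F \<Longrightarrow> M \<subseteq> X \<Longrightarrow> X = M" by blast
  have "\<exists>x\<in>M. dist x y < t" if "y \<in> A" for y
  proof (rule ccontr)
    assume far: "\<not> (\<exists>x\<in>M. dist x y < t)"
    then have "insert y M \<in> F"
      using M that by (auto simp: F_def pairwise_insert not_less dist_commute)
    then have "y \<in> M" using max by blast
    then show False using far assms(3) by auto
  qed
  then show thesis using M that by (auto simp: F_def)
qed

text \<open>The weights are treated in decreasing order of dyadic size.\<close>

lemma greedy_separated_selection:
  fixes A :: "'a::metric_space set" and w :: "'a \<Rightarrow> real"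
  assumes t: "0 < t" and M: "\<And>x. x \<in> A \<Longrightarrow> w x \<le> M"
  obtains S where "S \<subseteq> {x\<in>A. 0 < w x}" "pairwise (\<lambda>x y. t \<le> dist x y) S"
    "\<And>y. y \<in> A \<Longrightarrow> 0 < w y \<Longrightarrow> \<exists>x\<in>S. dist x y < t \<and> w y \<le> 2 * w x"
proof (cases "M \<le> 0")
  case True
  then have "\<not> 0 < w x" if "x \<in> A" for x using M[OF that] by linarith
  then show thesis using that[of "{}"] by auto
next
  case False
  define L where "L k = {x\<in>A. M / 2 ^ k < w x}" for k :: nat
  have mono: "L k \<subseteq> L (Suc k)" for k
    using False by (auto simp: L_def field_simps)
  \<comment> \<open>A net of one level need not cover the next level, but it can be extended to one
    that does. Dependent choice gives an increasing chain, whose union is still separated.\<close>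
  define P where "P k X \<longleftrightarrow> X \<subseteq> L k \<and> pairwise (\<lambda>x y. t \<le> dist x y) X \<and>
    (\<forall>y\<in>L k. \<exists>x\<in>X. dist x y < t)" for k X
  have "\<exists>Sq. \<forall>k. P k (Sq k) \<and> Sq k \<subseteq> Sq (Suc k)"
  proof (rule dependent_nat_choice)
    obtain X where "X \<subseteq> L 0" "pairwise (\<lambda>x y. t \<le> dist x y) X" "\<And>y. y \<in> L 0 \<Longrightarrow> \<exists>x\<in>X. dist x y < t"
      using maximal_separated_superset[of "{}" "L 0" t] t by auto
    then show "\<exists>X. P 0 X" by (auto simp: P_def)
  next
    fix X k assume "P k X"
    then have "X \<subseteq> L (Suc k)" "pairwise (\<lambda>x y. t \<le> dist x y) X"
      using mono[of k] by (auto simp: P_def)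
    then obtain X' where "X \<subseteq> X'" "X' \<subseteq> L (Suc k)" "pairwise (\<lambda>x y. t \<le> dist x y) X'"
      "\<And>y. y \<in> L (Suc k) \<Longrightarrow> \<exists>x\<in>X'. dist x y < t"
      using maximal_separated_superset[of X "L (Suc k)" t] t by blast
    then show "\<exists>X'. P (Suc k) X' \<and> X \<subseteq> X'" by (auto simp: P_def)
  qed
  then obtain Sq where Sq: "\<And>k. P k (Sq k)" and inc: "\<And>k. Sq k \<subseteq> Sq (Suc k)" by blast
  have inc': "i \<le> j \<Longrightarrow> Sq i \<subseteq> Sq j" for i j
    using inc by (rule lift_Suc_mono_le)
  show thesis
  proof
    have "0 < w x" if "x \<in> L k" for x k
      using that False order.strict_trans[of 0 "M / 2 ^ k" "w x"] by (auto simp: L_def)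
    then show "(\<Union>k. Sq k) \<subseteq> {x\<in>A. 0 < w x}"
      using Sq by (fastforce simp: P_def L_def)
    show "pairwise (\<lambda>x y. t \<le> dist x y) (\<Union>k. Sq k)"
    proof (rule pairwise_chain_Union)
      show "pairwise (\<lambda>x y. t \<le> dist x y) X" if "X \<in> range Sq" for X
        using that Sq by (auto simp: P_def)
      show "chain\<^sub>\<subseteq> (range Sq)"
        using inc' by (auto simp: chain_subset_def) (metis nat_le_linear subsetD)
    qed
    fix y assume y: "y \<in> A" "0 < w y"
    obtain n where "M / w y < 2 ^ n"
      using real_arch_pow[of 2 "M / w y"] by auto
    then have "M / 2 ^ n < w y" using y by (simp add: field_simps)
    then have ex: "\<exists>n. M / 2 ^ n < w y" by blast
    \<comment> \<open>At the least level that \<open>y\<close> exceeds, \<open>w y\<close> is at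
      most twice the threshold \<open>M / 2 ^ k\<close>, while every centre of \<open>Sq k\<close>
      has weight above that threshold; this is the factor 2. Level 0 is impossible because
      \<open>w y\<close> is at most \<open>M\<close>.\<close>
    define k where "k = (LEAST n. M / 2 ^ n < w y)"
    have k: "M / 2 ^ k < w y" unfolding k_def using ex by (rule LeastI_ex)
    have "k \<noteq> 0" using k M[OF y(1)] by (intro notI) simp
    then obtain j where j: "k = Suc j" by (cases k) auto
    have "w y \<le> M / 2 ^ j"
      using not_less_Least[of j "\<lambda>n. M / 2 ^ n < w y"] j by (auto simp: k_def not_less)
    then have le: "w y \<le> 2 * (M / 2 ^ k)" using j by simp
    from k y have "y \<in> L k" by (simp add: L_def)
    then obtain x where "x \<in> Sq k" "dist x y < t" using Sq[of k] by (auto simp: P_def)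
    moreover from this have "M / 2 ^ k < w x" using Sq[of k] by (auto simp: P_def L_def)
    ultimately show "\<exists>x\<in>\<Union>k. Sq k. dist x y < t \<and> w y \<le> 2 * w x"
      using le by (intro bexI[of _ x]) auto
  qed
qed

section \<open>Riesz potentials on upper Ahlfors regular spaces\<close>

text \<open>Enumerating the index set turns the integral into a series. This is what makes the
  majorant \<open>H\<close> of a ball integral measurable.\<close>

lemma borel_measurable_nn_integral_count_space:
  fixes f :: "'i \<Rightarrow> 'a \<Rightarrow> ennreal"
  assumes "countable I" and [measurable]: "\<And>i. i \<in> I \<Longrightarrow> f i \<in> borel_measurable M"
  shows "(\<lambda>x. \<integral>\<^sup>+i. f i x \<partial>count_space I) \<in> borel_measurable M"
proof (cases "finite I")
  case True
  then show ?thesis by (simp add: nn_integral_count_space_finite)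
next
  case False
  then have "I \<noteq> {}" by auto
  then have [measurable]: "f (from_nat_into I n) \<in> borel_measurable M" for n
    by (simp add: from_nat_into)
  have "(\<lambda>x. \<integral>\<^sup>+i. f i x \<partial>count_space I) = (\<lambda>x. \<Sum>n. f (from_nat_into I n) x)"
    by (simp add: nn_integral_bij_count_space[symmetric, OF bij_betw_from_nat_into[OF \<open>countable I\<close> False]]
        nn_integral_count_space_nat)
  then show ?thesis by simp
qed

text \<open>The ball estimate is asked for all radii, so that no threshold has to be tracked;
  \<open>upper_ahlfors_regular_global\<close> derives it from the local condition. The sigma-algebra
  may be larger than the Borel one, hence a mere inclusion in \<open>borel_sets\<close>.\<close>

locale ahlfors_space =
  fixes nu :: "'a::metric_space measure" and ups c :: real
  assumes borel_sets: "sets (restrict_space borel (space nu)) \<subseteq> sets nu"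
    and ups_pos: "0 < ups" and c_pos: "0 < c"
    and ball_le: "\<And>x r. x \<in> space nu \<Longrightarrow> 0 < r \<Longrightarrow>
      emeasure nu (ball x r \<inter> space nu) \<le> ennreal (c * r powr ups)"
begin

lemma continuous_borel_measurable:
  fixes f :: "'a \<Rightarrow> 'b::topological_space"
  assumes "continuous_on (space nu) f"
  shows "f \<in> borel_measurable nu"
proof -
  have "f \<in> borel_measurable (restrict_space borel (space nu))"
    by (rule borel_measurable_continuous_on_restrict[OF assms])
  then show ?thesis
    using measurable_mono[OF order_refl refl borel_sets] by (auto simp: space_restrict_space)
qed

lemma dist_borel_measurable [measurable]: "(\<lambda>y. dist x y) \<in> borel_measurable nu"
  by (intro continuous_borel_measurable continuous_intros)

lemma ball_measurable [measurable]: "ball x r \<inter> space nu \<in> sets nu"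
proof -
  have "{y \<in> space nu. dist x y < r} \<in> sets nu" by measurable
  then show ?thesis by (simp add: Int_def conj_commute)
qed

lemma indicator_ball_measurable [measurable]:
  "(indicator (ball x r) :: 'a \<Rightarrow> ennreal) \<in> borel_measurable nu"
  by (rule borel_measurable_indicator') (use ball_measurable in \<open>auto simp: Int_def conj_commute\<close>)

definition ball_integral :: "real \<Rightarrow> ('a \<Rightarrow> ennreal) \<Rightarrow> 'a \<Rightarrow> ennreal" where
  "ball_integral r f x = (\<integral>\<^sup>+y. indicator (ball x r) y * f y \<partial>nu)"

lemma ball_integral_le: "ball_integral r f x \<le> (\<integral>\<^sup>+y. f y \<partial>nu)"
  unfolding ball_integral_def by (intro nn_integral_mono) (auto split: split_indicator)

lemma ball_integral_1_le:
  assumes "x \<in> space nu" "0 < r"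
  shows "ball_integral r (\<lambda>_. 1) x \<le> ennreal (c * r powr ups)"
proof -
  have "ball_integral r (\<lambda>_. 1) x = (\<integral>\<^sup>+y. indicator (ball x r \<inter> space nu) y \<partial>nu)"
    unfolding ball_integral_def by (intro nn_integral_cong) (auto split: split_indicator)
  also have "\<dots> = emeasure nu (ball x r \<inter> space nu)" by simp
  finally show ?thesis using ball_le[OF assms] by simp
qed

text \<open>The space need not be separable, so Tonelli's theorem is not available for the
  kernel \<open>indicator {dist x y < r}\<close>. The selection lemma replaces it.\<close>

lemma ball_integral_majorant:
  assumes f [measurable]: "f \<in> borel_measurable nu" and fin: "(\<integral>\<^sup>+y. f y \<partial>nu) < \<infinity>" and r: "0 < r"
  obtains H where "H \<in> borel_measurable nu" "\<And>x. x \<in> space nu \<Longrightarrow> ball_integral r f x \<le> H x"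
    "(\<integral>\<^sup>+x. H x \<partial>nu) \<le> ennreal (2 * c * (2 * r) powr ups) * (\<integral>\<^sup>+y. f y \<partial>nu)"
proof -
  define I where "I = (\<integral>\<^sup>+y. f y \<partial>nu)"
  define w where "w x = enn2real (ball_integral r f x)" for x
  have I: "I < \<infinity>" using fin by (simp add: I_def)
  have wfin: "ball_integral r f x < \<infinity>" for x
    using ball_integral_le[of r f x] I by (simp add: I_def order_le_less_trans)
  have ew: "ennreal (w x) = ball_integral r f x" for x
    using wfin[of x] by (simp add: w_def less_top)
  have w0: "0 \<le> w x" for x by (simp add: w_def)
  have wI: "w x \<le> enn2real I" for x
    unfolding w_def using ball_integral_le[of r f x] I by (intro enn2real_mono) (auto simp: I_def)
  obtain S where S: "S \<subseteq> {x\<in>space nu. 0 < w x}" and sep: "pairwise (\<lambda>x y. 2 * r \<le> dist x y) S"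
    and cov: "\<And>y. y \<in> space nu \<Longrightarrow> 0 < w y \<Longrightarrow> \<exists>x\<in>S. dist x y < 2 * r \<and> w y \<le> 2 * w x"
    using greedy_separated_selection[of "2 * r" "space nu" w "enn2real I"] r wI by auto
  \<comment> \<open>Centres are \<open>2 * r\<close> apart, so the balls of radius \<open>r\<close>
    around them are disjoint and \<open>y\<close> lies in at most one.\<close>
  have disj: "(\<integral>\<^sup>+x. indicator (ball x r) y \<partial>count_space S) \<le> (1::ennreal)" for y
  proof (cases "\<exists>x\<in>S. y \<in> ball x r")
    case True
    then obtain x where x: "x \<in> S" "y \<in> ball x r" by blast
    have "indicator (ball z r) y \<le> (indicator {x} z :: ennreal)" if "z \<in> S" for z
    proof (cases "z = x")
      case False
      then have "2 * r \<le> dist x z" using sep that x by (auto simp: pairwise_def)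
      then have "y \<notin> ball z r" using x dist_triangle[of x z y] by (auto simp: dist_commute)
      then show ?thesis by simp
    qed (auto split: split_indicator)
    then have "(\<integral>\<^sup>+z. indicator (ball z r) y \<partial>count_space S) \<le> (\<integral>\<^sup>+z. indicator {x} z \<partial>count_space S)"
      by (intro nn_integral_mono) auto
    also have "\<dots> = 1" using x by (subst nn_integral_indicator) auto
    finally show ?thesis .
  next
    case False
    then have "(\<integral>\<^sup>+x. indicator (ball x r) y \<partial>count_space S) = (\<integral>\<^sup>+x. 0 \<partial>count_space S)"
      by (intro nn_integral_cong) (auto split: split_indicator)
    then show ?thesis by simp
  qed
  \<comment> \<open>Countability is needed to interchange the sum with the integral and is not yet
    known for \<open>S\<close>. Finite subsets suffice to prove it, after which the bound is applied
    to \<open>S\<close> itself.\<close>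
  have sumI: "(\<integral>\<^sup>+x. ennreal (w x) \<partial>count_space X) \<le> I" if "X \<subseteq> S" "countable X" for X
  proof -
    have "(\<integral>\<^sup>+x. ennreal (w x) \<partial>count_space X)
        = (\<integral>\<^sup>+x. (\<integral>\<^sup>+y. indicator (ball x r) y * f y \<partial>nu) \<partial>count_space X)"
      by (simp add: ew ball_integral_def)
    also have "\<dots> = (\<integral>\<^sup>+y. (\<integral>\<^sup>+x. indicator (ball x r) y * f y \<partial>count_space X) \<partial>nu)"
      by (rule nn_integral_count_space_nn_integral[symmetric]) (use that in auto)
    also have "\<dots> \<le> (\<integral>\<^sup>+y. 1 * f y \<partial>nu)"
    proof (intro nn_integral_mono)
      fix y
      have "(\<integral>\<^sup>+x. indicator (ball x r) y * f y \<partial>count_space X)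
          = (\<integral>\<^sup>+x. indicator (ball x r) y \<partial>count_space X) * f y"
        by (rule nn_integral_multc) auto
      also have "(\<integral>\<^sup>+x. indicator (ball x r) y \<partial>count_space X)
          \<le> (\<integral>\<^sup>+x. indicator (ball x r) y \<partial>count_space S)"
        using that by (simp add: nn_integral_count_space_indicator nn_integral_mono
            split: split_indicator) (auto intro!: nn_integral_mono split: split_indicator)
      also have "\<dots> \<le> (1::ennreal)" by (rule disj)
      finally show "(\<integral>\<^sup>+x. indicator (ball x r) y * f y \<partial>count_space X) \<le> 1 * f y"
        by (simp add: mult_right_mono)
    qed
    finally show ?thesis by (simp add: I_def)
  qed
  \<comment> \<open>A summable family has only countably many nonzero members, and every weight on
    \<open>S\<close> is positive.\<close>
  have "w summable_on S"
  proof (rule nonneg_bdd_above_summable_on)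
    show "bdd_above (sum w ` {F. F \<subseteq> S \<and> finite F})"
    proof (rule bdd_aboveI2)
      fix F assume F: "F \<in> {F. F \<subseteq> S \<and> finite F}"
      then have "ennreal (sum w F) \<le> I"
        using sumI[of F] by (simp add: nn_integral_count_space_finite w0 countable_finite sum_ennreal)
      then show "sum w F \<le> enn2real I"
        using I by (metis enn2real_ennreal enn2real_mono infinity_ennreal_def sum_nonneg w0)
    qed
  qed (use w0 in auto)
  then have "countable {x\<in>S. w x \<noteq> 0}"
    using w0 by (intro abs_summable_countable[of w]) simp
  then have cS: "countable S" using S by (auto elim!: back_subst[of countable])
  \<comment> \<open>A point of positive weight is within \<open>2 * r\<close> of a centre with at
    least half its weight, so one summand already dominates. Each summand integrates to
    \<open>2 * w x\<close> times the mass of a ball of radius \<open>2 * r\<close>, whence the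
    constant \<open>2 * c * (2 * r) powr ups\<close>.\<close>
  define H where "H y = (\<integral>\<^sup>+x. indicator (ball x (2 * r)) y * ennreal (2 * w x) \<partial>count_space S)" for y
  show thesis
  proof
    show "H \<in> borel_measurable nu"
      unfolding H_def by (rule borel_measurable_nn_integral_count_space[OF cS]) simp
    show "ball_integral r f y \<le> H y" if y: "y \<in> space nu" for y
    proof (cases "0 < w y")
      case True
      then obtain x where x: "x \<in> S" "dist x y < 2 * r" "w y \<le> 2 * w x" using cov y by blast
      have "ball_integral r f y \<le> ennreal (2 * w x)" using x by (simp flip: ew add: ennreal_leI)
      also have "\<dots> = (\<integral>\<^sup>+z. ennreal (2 * w x) * indicator {x} z \<partial>count_space S)"
        using x by (subst nn_integral_cmult_indicator) auto
      also have "\<dots> \<le> H y"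
        unfolding H_def using x by (intro nn_integral_mono) (auto split: split_indicator)
      finally show ?thesis .
    next
      case False
      then have "w y = 0" using w0[of y] by simp
      then show ?thesis using ew[of y] by simp
    qed
    have "(\<integral>\<^sup>+y. H y \<partial>nu)
        = (\<integral>\<^sup>+x. (\<integral>\<^sup>+y. indicator (ball x (2 * r)) y * ennreal (2 * w x) \<partial>nu) \<partial>count_space S)"
      unfolding H_def by (rule nn_integral_count_space_nn_integral) (use cS in auto)
    also have "\<dots> \<le> (\<integral>\<^sup>+x. ennreal (2 * c * (2 * r) powr ups) * ennreal (w x) \<partial>count_space S)"
    proof (intro nn_integral_mono)
      fix x assume "x \<in> space (count_space S)"
      then have "x \<in> space nu" using S by auto
      have "(\<integral>\<^sup>+y. indicator (ball x (2 * r)) y * ennreal (2 * w x) \<partial>nu)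
          = ball_integral (2 * r) (\<lambda>_. 1) x * ennreal (2 * w x)"
        by (simp add: ball_integral_def nn_integral_multc)
      also have "\<dots> \<le> ennreal (c * (2 * r) powr ups) * ennreal (2 * w x)"
        using ball_integral_1_le[of x "2 * r"] \<open>x \<in> space nu\<close> r by (intro mult_right_mono) auto
      also have "\<dots> = ennreal (2 * c * (2 * r) powr ups) * ennreal (w x)"
        using w0[of x] c_pos by (simp flip: ennreal_mult add: mult_ac)
      finally show "(\<integral>\<^sup>+y. indicator (ball x (2 * r)) y * ennreal (2 * w x) \<partial>nu)
          \<le> ennreal (2 * c * (2 * r) powr ups) * ennreal (w x)" .
    qed
    also have "\<dots> = ennreal (2 * c * (2 * r) powr ups) * (\<integral>\<^sup>+x. ennreal (w x) \<partial>count_space S)"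
      by (rule nn_integral_cmult) simp
    also have "\<dots> \<le> ennreal (2 * c * (2 * r) powr ups) * I"
      using sumI[of S] cS by (intro mult_left_mono) auto
    finally show "(\<integral>\<^sup>+x. H x \<partial>nu) \<le> ennreal (2 * c * (2 * r) powr ups) * (\<integral>\<^sup>+y. f y \<partial>nu)"
      by (simp add: I_def)
  qed
qed

end

section \<open>Dyadic estimates for the singular weight near its pole\<close>

lemma divide_power_powr:
  fixes e a b :: real
  assumes "0 < e" "0 < b"
  shows "(e / b ^ j) powr a = e powr a * (b powr (- a)) ^ j"
proof -
  have "(e / b ^ j) powr a = e powr a / b powr (real j * a)"
    using assms by (simp add: powr_divide powr_powr flip: powr_realpow)
  also have "\<dots> = e powr a * b powr (- a * real j)"
    by (simp add: powr_minus_divide mult.commute)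
  finally show ?thesis using assms by (simp add: powr_powr flip: powr_realpow)
qed

lemma ex_dyadic_shell:
  fixes d e :: real
  assumes "0 < d" "d < e"
  obtains j :: nat where "d < e / 2 ^ j" "e / 2 ^ Suc j \<le> d"
proof -
  obtain n where "e / d < 2 ^ n" using real_arch_pow[of 2 "e / d"] by auto
  then have ex: "\<exists>n. e / 2 ^ n \<le> d"
    using assms by (intro exI[of _ n]) (simp add: field_simps)
  define k where "k = (LEAST n. e / 2 ^ n \<le> d)"
  have k: "e / 2 ^ k \<le> d" unfolding k_def using ex by (rule LeastI_ex)
  have "k \<noteq> 0" using k assms by (intro notI) simp
  then obtain j where j: "k = Suc j" by (cases k) auto
  have "d < e / 2 ^ j"
    using not_less_Least[of j "\<lambda>n. e / 2 ^ n \<le> d"] j by (auto simp: k_def not_le)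
  then show thesis using k that by (auto simp: j)
qed

context ahlfors_space
begin

text \<open>This is the operator P of the overview. At \<open>y = x\<close> the weight is 0, since
  \<open>0 powr a = 0\<close> for every \<open>a\<close>; points turn out to be null sets
  (\<open>AE_neq_point\<close>), so nothing is lost.\<close>

definition riesz_integral :: "real \<Rightarrow> real \<Rightarrow> ('a \<Rightarrow> ennreal) \<Rightarrow> 'a \<Rightarrow> ennreal" where
  "riesz_integral s e f x = (\<integral>\<^sup>+y. indicator (ball x e) y * ennreal (dist x y powr - s) * f y \<partial>nu)"

text \<open>On a dyadic shell the weight is at most its value at the inner radius, half the outer
  one, which costs the factor \<open>2 powr s\<close>. The shell is then enlarged to its full
  ball.\<close>

lemma riesz_integral_le_ball_integrals:
  assumes f [measurable]: "f \<in> borel_measurable nu" and s: "0 \<le> s" and e: "0 < e"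
  shows "riesz_integral s e f x
    \<le> (\<Sum>j. ennreal (2 powr s * (e / 2 ^ j) powr - s) * ball_integral (e / 2 ^ j) f x)"
proof -
  have "riesz_integral s e f x
      \<le> (\<integral>\<^sup>+y. (\<Sum>j. ennreal (2 powr s * (e / 2 ^ j) powr - s) * (indicator (ball x (e / 2 ^ j)) y * f y)) \<partial>nu)"
    unfolding riesz_integral_def
  proof (rule nn_integral_mono)
    fix y
    show "indicator (ball x e) y * ennreal (dist x y powr - s) * f y
      \<le> (\<Sum>j. ennreal (2 powr s * (e / 2 ^ j) powr - s) * (indicator (ball x (e / 2 ^ j)) y * f y))"
      (is "_ \<le> suminf ?t")
    proof (cases "0 < dist x y \<and> dist x y < e")
      case True
      then obtain j where j: "dist x y < e / 2 ^ j" "e / 2 ^ Suc j \<le> dist x y"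
        using ex_dyadic_shell by blast
      have "dist x y powr - s \<le> (e / 2 ^ Suc j) powr - s"
        using j s e by (intro powr_mono2') auto
      also have "\<dots> = 2 powr s * (e / 2 ^ j) powr - s"
        using e by (simp add: powr_divide powr_mult powr_minus field_simps)
      finally have "indicator (ball x e) y * ennreal (dist x y powr - s) * f y \<le> ?t j"
        using j True by (auto simp: ennreal_leI mult_right_mono split: split_indicator)
      also have "\<dots> \<le> suminf ?t"
        using sum_le_suminf[of ?t "{j}"] by (simp add: summableI)
      finally show ?thesis .
    next
      case False
      then show ?thesis by (auto split: split_indicator)
    qed
  qed
  also have "\<dots> = (\<Sum>j. ennreal (2 powr s * (e / 2 ^ j) powr - s) * ball_integral (e / 2 ^ j) f x)"
    unfolding ball_integral_def by (simp add: nn_integral_suminf nn_integral_cmult)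
  finally show ?thesis .
qed

text \<open>The sum of the geometric series with ratio \<open>2 powr (s - ups)\<close> in
  \<open>suminf_dyadic\<close>. It uses the bound \<open>2 * c * (2 * r) powr ups\<close> of
  \<open>ball_integral_majorant\<close> instead of the smaller \<open>c * r powr ups\<close>, so
  that one constant serves bounded and integrable functions alike.\<close>

definition riesz_const :: "real \<Rightarrow> real" where
  "riesz_const s = 2 powr s * (2 * c * 2 powr ups) / (1 - 2 powr (s - ups))"

lemma riesz_const_pos: "s < ups \<Longrightarrow> 0 < riesz_const s"
  unfolding riesz_const_def using c_pos by (simp add: powr_less_one)

lemma suminf_dyadic:
  assumes "s < ups" "0 < e"
  shows "(\<Sum>j. ennreal (2 powr s * (e / 2 ^ j) powr - s) * ennreal (2 * c * (2 * (e / 2 ^ j)) powr ups))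
    = ennreal (riesz_const s * e powr (ups - s))"
proof -
  define q where "q = 2 powr (s - ups)"
  have q: "0 \<le> q" "q < 1" using assms by (auto simp: q_def powr_less_one)
  have term_eq: "2 powr s * (e / 2 ^ j) powr - s * (2 * c * (2 * (e / 2 ^ j)) powr ups)
      = 2 powr s * (2 * c * 2 powr ups) * e powr (ups - s) * q ^ j" for j
  proof -
    have "2 powr s * (e / 2 ^ j) powr - s * (2 * c * (2 * (e / 2 ^ j)) powr ups)
      = 2 powr s * (2 * c * 2 powr ups) * (e / 2 ^ j) powr (ups - s)"
      using assms unfolding powr_mult[of 2 "e / 2 ^ j"]
      by (simp add: powr_diff powr_minus field_simps)
    also have "(e / 2 ^ j) powr (ups - s) = e powr (ups - s) * q ^ j"
      using assms by (simp add: divide_power_powr q_def)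
    finally show ?thesis by simp
  qed
  have "(\<lambda>j. 2 powr s * (2 * c * 2 powr ups) * e powr (ups - s) * q ^ j) sums
      (2 powr s * (2 * c * 2 powr ups) * e powr (ups - s) * (1 / (1 - q)))"
    using q by (intro sums_mult geometric_sums) auto
  then have "(\<lambda>j. 2 powr s * (2 * c * 2 powr ups) * e powr (ups - s) * q ^ j) sums
      (riesz_const s * e powr (ups - s))"
    by (simp add: riesz_const_def q_def)
  then show ?thesis
    using c_pos q by (subst ennreal_mult[symmetric]) (auto simp: term_eq simp del: times_divide_eq_right intro!: suminf_ennreal_eq)
qed

lemma riesz_integral_1_le:
  assumes x: "x \<in> space nu" and s: "0 \<le> s" "s < ups" and e: "0 < e"
  shows "riesz_integral s e (\<lambda>_. 1) x \<le> ennreal (riesz_const s * e powr (ups - s))"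
proof -
  have "c * r powr ups \<le> 2 * c * (2 * r) powr ups" if "0 < r" for r
  proof -
    have "r powr ups \<le> (2 * r) powr ups" using that ups_pos by (intro powr_mono2) auto
    also have "\<dots> \<le> 2 * (2 * r) powr ups" by simp
    finally show ?thesis using c_pos by simp
  qed
  then have "ball_integral r (\<lambda>_. 1) x \<le> ennreal (2 * c * (2 * r) powr ups)" if "0 < r" for r
    using ball_integral_1_le[OF x that] that by (blast intro: order_trans ennreal_leI)
  then have "ball_integral (e / 2 ^ j) (\<lambda>_. 1) x \<le> ennreal (2 * c * (2 * (e / 2 ^ j)) powr ups)" for j
    using e by (metis zero_less_divide_iff zero_less_numeral zero_less_power)
  then have "(\<Sum>j. ennreal (2 powr s * (e / 2 ^ j) powr - s) * ball_integral (e / 2 ^ j) (\<lambda>_. 1) x)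
    \<le> (\<Sum>j. ennreal (2 powr s * (e / 2 ^ j) powr - s) * ennreal (2 * c * (2 * (e / 2 ^ j)) powr ups))"
    by (intro suminf_le mult_left_mono summableI) auto
  then show ?thesis
    using riesz_integral_le_ball_integrals[of "\<lambda>_. 1" s e x] s e suminf_dyadic[of s e]
    by (simp add: order_trans)
qed

text \<open>Each dyadic radius has its own majorant, and their weighted sum is again measurable.
  This plays the role of the L^1 bound for the potential.\<close>

lemma riesz_integral_majorant:
  assumes f [measurable]: "f \<in> borel_measurable nu" and fin: "(\<integral>\<^sup>+y. f y \<partial>nu) < \<infinity>"
    and s: "0 \<le> s" "s < ups" and e: "0 < e"
  obtains H where "H \<in> borel_measurable nu" "\<And>x. x \<in> space nu \<Longrightarrow> riesz_integral s e f x \<le> H x"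
    "(\<integral>\<^sup>+x. H x \<partial>nu) \<le> ennreal (riesz_const s * e powr (ups - s)) * (\<integral>\<^sup>+y. f y \<partial>nu)"
proof -
  have "\<exists>H. H \<in> borel_measurable nu \<and> (\<forall>x\<in>space nu. ball_integral (e / 2 ^ j) f x \<le> H x) \<and>
    (\<integral>\<^sup>+x. H x \<partial>nu) \<le> ennreal (2 * c * (2 * (e / 2 ^ j)) powr ups) * (\<integral>\<^sup>+y. f y \<partial>nu)" for j :: nat
    using ball_integral_majorant[OF f fin, of "e / 2 ^ j"] e by (metis zero_less_divide_iff zero_less_numeral zero_less_power)
  then obtain H where [measurable]: "\<And>j. H j \<in> borel_measurable nu"
    and HB: "\<And>j x. x \<in> space nu \<Longrightarrow> ball_integral (e / 2 ^ j) f x \<le> H j x"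
    and HI: "\<And>j. (\<integral>\<^sup>+x. H j x \<partial>nu) \<le> ennreal (2 * c * (2 * (e / 2 ^ j)) powr ups) * (\<integral>\<^sup>+y. f y \<partial>nu)"
    by metis
  define a where "a j = ennreal (2 powr s * (e / 2 ^ j) powr - s)" for j :: nat
  show thesis
  proof
    show "(\<lambda>x. \<Sum>j. a j * H j x) \<in> borel_measurable nu" by measurable
    show "riesz_integral s e f x \<le> (\<Sum>j. a j * H j x)" if "x \<in> space nu" for x
    proof -
      have "(\<Sum>j. a j * ball_integral (e / 2 ^ j) f x) \<le> (\<Sum>j. a j * H j x)"
        using HB[OF that] by (intro suminf_le mult_left_mono summableI) auto
      then show ?thesis
        using riesz_integral_le_ball_integrals[OF f s(1) e, of x] by (simp add: a_def)
    qed
    have "(\<integral>\<^sup>+x. (\<Sum>j. a j * H j x) \<partial>nu) = (\<Sum>j. a j * (\<integral>\<^sup>+x. H j x \<partial>nu))"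
      by (simp add: nn_integral_suminf nn_integral_cmult)
    also have "\<dots> \<le> (\<Sum>j. a j * ennreal (2 * c * (2 * (e / 2 ^ j)) powr ups) * (\<integral>\<^sup>+y. f y \<partial>nu))"
      using HI by (intro suminf_le summableI) (simp_all add: mult_left_mono mult.assoc)
    also have "\<dots> = ennreal (riesz_const s * e powr (ups - s)) * (\<integral>\<^sup>+y. f y \<partial>nu)"
      using suminf_dyadic[OF s(2) e] by (simp add: a_def)
    finally show "(\<integral>\<^sup>+x. (\<Sum>j. a j * H j x) \<partial>nu)
      \<le> ennreal (riesz_const s * e powr (ups - s)) * (\<integral>\<^sup>+y. f y \<partial>nu)" .
  qed
qed

section \<open>Boundedness from an integral inequality\<close>

text \<open>The cut at \<open>2 * G\<close> is the level that reproduces itself: by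
  \<open>small\<close>, the potential of the constant \<open>2 * G\<close>, multiplied by
  \<open>C\<close>, is at most \<open>G\<close>, and together with the given \<open>G\<close> it is
  absorbed by the cut. Only the excess \<open>v\<close> remains on the right, and its integral is at
  most half of itself.\<close>

lemma AE_bounded_of_riesz_inequality:
  fixes u :: "'a \<Rightarrow> real"
  assumes u [measurable]: "u \<in> borel_measurable nu" and u0: "\<And>x. 0 \<le> u x"
    and fin: "(\<integral>\<^sup>+y. ennreal (u y) \<partial>nu) < \<infinity>"
    and s: "0 \<le> s" "s < ups" and e: "0 < e" and C: "0 \<le> C" and G: "0 \<le> G"
    and small: "C * (riesz_const s * e powr (ups - s)) \<le> 1 / 2"
    and ineq: "AE x in nu. ennreal (u x) \<le> ennreal G + ennreal C * riesz_integral s e (\<lambda>y. ennreal (u y)) x"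
  shows "AE x in nu. u x \<le> 2 * G"
proof -
  define v where "v x = max 0 (u x - 2 * G)" for x
  have [measurable]: "v \<in> borel_measurable nu" unfolding v_def by measurable
  have v0: "0 \<le> v x" and uv: "u x \<le> 2 * G + v x" and vu: "v x \<le> u x" for x
    using u0[of x] G by (auto simp: v_def)
  have vfin: "(\<integral>\<^sup>+y. ennreal (v y) \<partial>nu) < \<infinity>"
    by (rule order_le_less_trans[OF _ fin]) (intro nn_integral_mono ennreal_leI vu)
  obtain H where [measurable]: "H \<in> borel_measurable nu"
    and H: "\<And>x. x \<in> space nu \<Longrightarrow> riesz_integral s e (\<lambda>y. ennreal (v y)) x \<le> H x"
    and HI: "(\<integral>\<^sup>+x. H x \<partial>nu) \<le> ennreal (riesz_const s * e powr (ups - s)) * (\<integral>\<^sup>+y. ennreal (v y) \<partial>nu)"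
    using riesz_integral_majorant[of "\<lambda>y. ennreal (v y)" s e] vfin s e by auto
  have half: "ennreal C * ennreal (riesz_const s * e powr (ups - s)) \<le> ennreal (1 / 2)"
    using small C riesz_const_pos[OF s(2)] by (simp flip: ennreal_mult add: ennreal_leI del: ennreal_half)
  have "AE x in nu. ennreal (v x) \<le> ennreal C * H x"
    using ineq AE_space
  proof eventually_elim
    case (elim x)
    let ?R = "riesz_integral s e"
    have "?R (\<lambda>y. ennreal (u y)) x
        \<le> (\<integral>\<^sup>+y. ennreal (2 * G) * (indicator (ball x e) y * ennreal (dist x y powr - s) * 1)
            + indicator (ball x e) y * ennreal (dist x y powr - s) * ennreal (v y) \<partial>nu)"
      unfolding riesz_integral_def
    proof (rule nn_integral_mono)
      fix y
      have "ennreal (u y) \<le> ennreal (2 * G) + ennreal (v y)"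
        using uv[of y] v0[of y] G by (simp flip: ennreal_plus add: ennreal_leI)
      then have "indicator (ball x e) y * ennreal (dist x y powr - s) * ennreal (u y)
        \<le> indicator (ball x e) y * ennreal (dist x y powr - s) * (ennreal (2 * G) + ennreal (v y))"
        by (rule mult_left_mono) simp
      then show "indicator (ball x e) y * ennreal (dist x y powr - s) * ennreal (u y)
        \<le> ennreal (2 * G) * (indicator (ball x e) y * ennreal (dist x y powr - s) * 1)
            + indicator (ball x e) y * ennreal (dist x y powr - s) * ennreal (v y)"
        by (simp add: distrib_left mult_ac)
    qed
    also have "\<dots> = ennreal (2 * G) * ?R (\<lambda>_. 1) x + ?R (\<lambda>y. ennreal (v y)) x"
      unfolding riesz_integral_def by (subst nn_integral_add) (auto simp: nn_integral_cmult)
    also have "\<dots> \<le> ennreal (2 * G) * ennreal (riesz_const s * e powr (ups - s)) + H x"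
      using elim H riesz_integral_1_le[of x s e] s e by (intro add_mono mult_left_mono) auto
    finally have "ennreal C * ?R (\<lambda>y. ennreal (u y)) x
      \<le> ennreal C * (ennreal (2 * G) * ennreal (riesz_const s * e powr (ups - s)) + H x)"
      by (rule mult_left_mono) simp
    also have "\<dots> = ennreal (2 * G) * (ennreal C * ennreal (riesz_const s * e powr (ups - s))) + ennreal C * H x"
      by (simp add: distrib_left mult_ac)
    also have "\<dots> \<le> ennreal (2 * G) * ennreal (1 / 2) + ennreal C * H x"
      by (intro add_right_mono mult_left_mono half) simp
    also have "ennreal (2 * G) * ennreal (1 / 2) = ennreal G"
      using G by (simp flip: ennreal_mult del: ennreal_half)
    finally have "ennreal C * ?R (\<lambda>y. ennreal (u y)) x \<le> ennreal G + ennreal C * H x" .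
    then have "ennreal (u x) \<le> ennreal G + (ennreal G + ennreal C * H x)"
      using elim(1) by (meson add_left_mono order_trans)
    then have "ennreal (u x) \<le> ennreal (2 * G) + ennreal C * H x"
      using G by (simp add: ennreal_plus[symmetric] flip: add.assoc del: ennreal_plus)
    then have "ennreal (u x) - ennreal (2 * G) \<le> ennreal C * H x"
      by (simp add: ennreal_minus_le_iff)
    then show ?case
      using G by (simp add: v_def ennreal_minus max_def split: if_splits)
  qed
  then have "(\<integral>\<^sup>+x. ennreal (v x) \<partial>nu) \<le> (\<integral>\<^sup>+x. ennreal C * H x \<partial>nu)"
    by (rule nn_integral_mono_AE)
  also have "\<dots> = ennreal C * (\<integral>\<^sup>+x. H x \<partial>nu)" by (simp add: nn_integral_cmult)
  also have "\<dots> \<le> ennreal C * (ennreal (riesz_const s * e powr (ups - s)) * (\<integral>\<^sup>+y. ennreal (v y) \<partial>nu))"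
    using HI by (intro mult_left_mono) auto
  also have "\<dots> \<le> ennreal (1 / 2) * (\<integral>\<^sup>+y. ennreal (v y) \<partial>nu)"
    using half by (simp add: mult_right_mono flip: mult.assoc del: ennreal_half)
  finally have le: "(\<integral>\<^sup>+x. ennreal (v x) \<partial>nu) \<le> ennreal (1 / 2) * (\<integral>\<^sup>+y. ennreal (v y) \<partial>nu)" .
  \<comment> \<open>Finiteness of the integral is essential here: it turns
    \<open>t \<le> 1 / 2 * t\<close> into \<open>t = 0\<close>.\<close>
  obtain t where t: "0 \<le> t" "(\<integral>\<^sup>+x. ennreal (v x) \<partial>nu) = ennreal t"
    using vfin by (cases "\<integral>\<^sup>+x. ennreal (v x) \<partial>nu") auto
  have "ennreal t \<le> ennreal (1 / 2 * t)"
    using le unfolding t(2) by (subst ennreal_mult) (use t(1) in auto)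
  then have "t \<le> 1 / 2 * t" using t(1) by (subst (asm) ennreal_le_iff) auto
  then have "(\<integral>\<^sup>+x. ennreal (v x) \<partial>nu) = 0" using t by auto
  then have "AE x in nu. ennreal (v x) = 0" by (subst (asm) nn_integral_0_iff_AE) auto
  then show ?thesis by eventually_elim (use v0 in \<open>auto simp: v_def split: if_splits\<close>)
qed

section \<open>Integrals away from the pole\<close>

text \<open>The \<open>N\<close> shells from \<open>\<rho> * 2 ^ j\<close> to
  \<open>\<rho> * 2 ^ Suc j\<close> exhaust the space outside the ball. On each, the weight is
  bounded at the inner radius and the mass at the outer one, hence the factor
  \<open>2 powr ups\<close>.\<close>

lemma far_integral_le:
  assumes x: "x \<in> space nu" and s: "0 \<le> s" and rho: "0 < \<rho>"
    and D: "\<And>y. y \<in> space nu \<Longrightarrow> dist x y < \<rho> * 2 ^ N"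
  shows "(\<integral>\<^sup>+y. indicator (- ball x \<rho>) y * ennreal (dist x y powr - s) \<partial>nu)
    \<le> ennreal (\<Sum>j<N. c * 2 powr ups * (\<rho> * 2 ^ j) powr (ups - s))"
proof -
  have "(\<integral>\<^sup>+y. indicator (- ball x \<rho>) y * ennreal (dist x y powr - s) \<partial>nu)
    \<le> (\<integral>\<^sup>+y. (\<Sum>j<N. ennreal ((\<rho> * 2 ^ j) powr - s) * (indicator (ball x (\<rho> * 2 ^ Suc j)) y * 1)) \<partial>nu)"
  proof (rule nn_integral_mono)
    fix y assume y: "y \<in> space nu"
    show "indicator (- ball x \<rho>) y * ennreal (dist x y powr - s)
      \<le> (\<Sum>j<N. ennreal ((\<rho> * 2 ^ j) powr - s) * (indicator (ball x (\<rho> * 2 ^ Suc j)) y * 1))"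
      (is "_ \<le> sum ?t _")
    proof (cases "\<rho> \<le> dist x y")
      case True
      obtain i where i: "dist x y < \<rho> * 2 ^ N / 2 ^ i" "\<rho> * 2 ^ N / 2 ^ Suc i \<le> dist x y"
        using ex_dyadic_shell[of "dist x y" "\<rho> * 2 ^ N"] D[OF y] True rho
        by (metis order_less_le_trans)
      have "i < N"
      proof (rule ccontr)
        assume "\<not> i < N"
        then have "(2::real) ^ N \<le> 2 ^ i" by simp
        then have "\<rho> * 2 ^ N / 2 ^ i \<le> \<rho>" using rho by (simp add: field_simps)
        then show False using i True by linarith
      qed
      \<comment> \<open>\<open>ex_dyadic_shell\<close> counts inwards from the outermost radius,
        whereas the sum counts outwards from \<open>\<rho>\<close>.\<close>
      define j where "j = N - Suc i"
      have N: "N = Suc j + i" using \<open>i < N\<close> by (simp add: j_def)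
      have j: "j < N" "dist x y < \<rho> * 2 ^ Suc j" "\<rho> * 2 ^ j \<le> dist x y"
        using i by (auto simp: N power_add field_simps)
      have "dist x y powr - s \<le> (\<rho> * 2 ^ j) powr - s"
        using j s rho by (intro powr_mono2') auto
      then have "indicator (- ball x \<rho>) y * ennreal (dist x y powr - s) \<le> ?t j"
        using j by (auto simp: ennreal_leI split: split_indicator)
      also have "\<dots> \<le> sum ?t {..<N}" using j by (intro member_le_sum) auto
      finally show ?thesis .
    qed auto
  qed
  also have "\<dots> = (\<Sum>j<N. ennreal ((\<rho> * 2 ^ j) powr - s) * ball_integral (\<rho> * 2 ^ Suc j) (\<lambda>_. 1) x)"
    unfolding ball_integral_def by (subst nn_integral_sum) (measurable, simp add: nn_integral_cmult)
  also have "\<dots> \<le> (\<Sum>j<N. ennreal ((\<rho> * 2 ^ j) powr - s) * ennreal (c * (\<rho> * 2 ^ Suc j) powr ups))"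
    using rho x by (intro sum_mono mult_left_mono ball_integral_1_le) auto
  also have "\<dots> = (\<Sum>j<N. ennreal (c * 2 powr ups * (\<rho> * 2 ^ j) powr (ups - s)))"
  proof (intro sum.cong refl)
    fix j
    have "(\<rho> * 2 ^ Suc j) powr ups = 2 powr ups * (\<rho> * 2 ^ j) powr ups"
      using powr_mult[of 2 "\<rho> * 2 ^ j" ups] rho by (simp add: mult_ac)
    then have "(\<rho> * 2 ^ j) powr - s * (c * (\<rho> * 2 ^ Suc j) powr ups) = c * 2 powr ups * (\<rho> * 2 ^ j) powr (ups - s)"
      by (simp add: powr_diff powr_minus field_simps)
    then show "ennreal ((\<rho> * 2 ^ j) powr - s) * ennreal (c * (\<rho> * 2 ^ Suc j) powr ups)
      = ennreal (c * 2 powr ups * (\<rho> * 2 ^ j) powr (ups - s))"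
      using c_pos by (simp flip: ennreal_mult)
  qed
  also have "\<dots> = ennreal (\<Sum>j<N. c * 2 powr ups * (\<rho> * 2 ^ j) powr (ups - s))"
    using c_pos by (intro sum_ennreal) auto
  finally show ?thesis .
qed

end

lemma ex_powr_mult_eq:
  fixes a b \<epsilon> :: real
  assumes "0 < a" "0 < b" "0 < \<epsilon>"
  obtains e where "0 < e" "b * e powr a = \<epsilon>"
proof
  show "0 < (\<epsilon> / b) powr (1 / a)" "b * ((\<epsilon> / b) powr (1 / a)) powr a = \<epsilon>"
    using assms by (simp_all add: powr_powr)
qed

context ahlfors_space
begin

text \<open>Balls shrinking to \<open>x\<close> have mass at most \<open>c * r powr ups\<close>,
  which tends to 0. Hence kernel bounds that hold only off the diagonal suffice under the
  integral.\<close>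

lemma AE_neq_point:
  assumes x: "x \<in> space nu"
  shows "AE y in nu. y \<noteq> x"
proof -
  have m: "{y \<in> space nu. dist x y \<le> 0} \<in> sets nu" by measurable
  have "emeasure nu {y \<in> space nu. dist x y \<le> 0} \<le> ennreal \<epsilon>" if eps: "0 < \<epsilon>" for \<epsilon>
  proof -
    obtain r where r: "0 < r" "c * r powr ups = \<epsilon>"
      using ex_powr_mult_eq[OF ups_pos c_pos eps] .
    have "emeasure nu {y \<in> space nu. dist x y \<le> 0} \<le> emeasure nu (ball x r \<inter> space nu)"
      using r by (intro emeasure_mono) auto
    also have "\<dots> \<le> ennreal \<epsilon>" using ball_le[OF x r(1)] r(2) by simp
    finally show ?thesis .
  qed
  then have "emeasure nu {y \<in> space nu. dist x y \<le> 0} \<le> 0"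
    using ennreal_le_epsilon[of 0 "emeasure nu {y \<in> space nu. dist x y \<le> 0}"] by simp
  then have "{y \<in> space nu. dist x y \<le> 0} \<in> null_sets nu" using m by (auto simp: null_sets_def)
  then show ?thesis by (rule AE_I') auto
qed

text \<open>Kernels are continuous only off the diagonal. The singleton is Borel, so the value at
  \<open>x\<close> can be glued in.\<close>

lemma borel_measurable_continuous_off_point:
  fixes f :: "'a \<Rightarrow> 'b::topological_space"
  assumes f: "continuous_on (space nu - {x}) f"
  shows "f \<in> borel_measurable nu"
proof -
  let ?M = "restrict_space borel (space nu)"
  have "{x} \<in> sets (borel :: 'a measure)" by simp
  then have "{y \<in> space ?M. y = x} \<in> sets ?M"
    by (auto simp: space_restrict_space sets_restrict_space image_iff intro!: bexI[of _ "{x}"])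
  moreover have "f \<in> borel_measurable (restrict_space ?M {y. y \<noteq> x})"
  proof -
    have "space nu \<inter> {y. y \<noteq> x} = space nu - {x}" by auto
    then have "sets (restrict_space ?M {y. y \<noteq> x}) = sets (restrict_space borel (space nu - {x}))"
      by (simp add: sets_restrict_restrict_space)
    then show ?thesis
      using borel_measurable_continuous_on_restrict[OF f] measurable_cong_sets by blast
  qed
  moreover have "(\<lambda>_. f x) \<in> borel_measurable (restrict_space ?M {y. y = x})" by simp
  ultimately have "(\<lambda>y. if y = x then f x else f y) \<in> borel_measurable ?M"
    by (subst measurable_If_restrict_space_iff) auto
  moreover have "(\<lambda>y. if y = x then f x else f y) = f" by auto
  ultimately show ?thesis
    using measurable_mono[OF order_refl refl borel_sets] by (auto simp: space_restrict_space)
qed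

text \<open>The weight is integrable across its pole, so the integral over all of
  \<open>ball x D\<close> gives a bound independent of \<open>\<rho>\<close>.\<close>

lemma far_integral_subcritical:
  assumes x: "x \<in> space nu" and s: "0 \<le> s" "s < ups" and D: "\<And>y. y \<in> space nu \<Longrightarrow> dist x y < D"
  shows "(\<integral>\<^sup>+y. indicator (- ball x \<rho>) y * ennreal (dist x y powr - s) \<partial>nu)
    \<le> ennreal (riesz_const s * D powr (ups - s))"
proof -
  have "0 < D" using D[OF x] by simp
  have "(\<integral>\<^sup>+y. indicator (- ball x \<rho>) y * ennreal (dist x y powr - s) \<partial>nu) \<le> riesz_integral s D (\<lambda>_. 1) x"
    unfolding riesz_integral_def using D
    by (intro nn_integral_mono) (auto split: split_indicator)
  also have "\<dots> \<le> ennreal (riesz_const s * D powr (ups - s))"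
    by (rule riesz_integral_1_le[OF x s \<open>0 < D\<close>])
  finally show ?thesis .
qed

text \<open>For exponent \<open>ups\<close> every shell contributes the same amount
  \<open>c * 2 powr ups\<close>; the logarithm is the number of shells.\<close>

lemma far_integral_critical:
  assumes x: "x \<in> space nu" and D: "\<And>y. y \<in> space nu \<Longrightarrow> dist x y < D"
    and rho: "0 < \<rho>" "\<rho> \<le> 2 * D"
  shows "(\<integral>\<^sup>+y. indicator (- ball x \<rho>) y * ennreal (dist x y powr - ups) \<partial>nu)
    \<le> ennreal (c * 2 powr ups * (1 + log 2 (2 * D / \<rho>)))"
proof -
  \<comment> \<open>The numerator is \<open>2 * D\<close> so that for \<open>\<rho>\<close> twice a
    distance \<open>\<delta>\<close> below \<open>D\<close> the logarithm becomes that of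
    \<open>D / \<delta>\<close>, which is positive.\<close>
  define N where "N = nat \<lceil>log 2 (2 * D / \<rho>)\<rceil>"
  have D0: "0 < D" using D[OF x] by simp
  have "0 \<le> log 2 (2 * D / \<rho>)" using rho D0 by simp
  then have N: "log 2 (2 * D / \<rho>) \<le> real N" "real N \<le> 1 + log 2 (2 * D / \<rho>)"
    by (auto simp: N_def) linarith+
  then have "2 * D / \<rho> \<le> 2 ^ N"
    using rho D0 by (simp add: log_le_iff powr_realpow)
  then have "2 * D \<le> \<rho> * 2 ^ N" using rho by (simp add: field_simps)
  then have "dist x y < \<rho> * 2 ^ N" if "y \<in> space nu" for y
    using D[OF that] D0 by linarith
  from far_integral_le[OF x _ rho(1) this, of ups]
  have "(\<integral>\<^sup>+y. indicator (- ball x \<rho>) y * ennreal (dist x y powr - ups) \<partial>nu)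
    \<le> ennreal (\<Sum>j<N. c * 2 powr ups * (\<rho> * 2 ^ j) powr 0)"
    using ups_pos by simp
  also have "(\<Sum>j<N. c * 2 powr ups * (\<rho> * 2 ^ j) powr 0) = c * 2 powr ups * real N"
    using rho by simp
  also have "ennreal \<dots> \<le> ennreal (c * 2 powr ups * (1 + log 2 (2 * D / \<rho>)))"
    using N c_pos by (intro ennreal_leI mult_left_mono) auto
  finally show ?thesis .
qed

text \<open>The shell contributions decay geometrically outwards, so the innermost one determines
  the size and the number of shells drops out.\<close>

lemma far_integral_supercritical:
  assumes x: "x \<in> space nu" and D: "\<And>y. y \<in> space nu \<Longrightarrow> dist x y < D"
    and rho: "0 < \<rho>" and s: "ups < s"
  shows "(\<integral>\<^sup>+y. indicator (- ball x \<rho>) y * ennreal (dist x y powr - s) \<partial>nu)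
    \<le> ennreal (c * 2 powr ups / (1 - 2 powr (ups - s)) * \<rho> powr (ups - s))"
proof -
  obtain N where "D / \<rho> < 2 ^ N" using real_arch_pow[of 2 "D / \<rho>"] by auto
  then have "D < \<rho> * 2 ^ N" using rho by (simp add: field_simps)
  then have "dist x y < \<rho> * 2 ^ N" if "y \<in> space nu" for y
    using D[OF that] by linarith
  from far_integral_le[OF x _ rho(1) this, of s]
  have "(\<integral>\<^sup>+y. indicator (- ball x \<rho>) y * ennreal (dist x y powr - s) \<partial>nu)
    \<le> ennreal (\<Sum>j<N. c * 2 powr ups * (\<rho> * 2 ^ j) powr (ups - s))"
    using ups_pos s by simp
  also have "\<dots> \<le> ennreal (c * 2 powr ups / (1 - 2 powr (ups - s)) * \<rho> powr (ups - s))"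
  proof (rule ennreal_leI)
    define q where "q = 2 powr (ups - s)"
    have q: "0 \<le> q" "q < 1" using s by (auto simp: q_def powr_less_one)
    have "(\<rho> * 2 ^ j) powr (ups - s) = \<rho> powr (ups - s) * q ^ j" for j
      using rho by (simp add: q_def powr_mult powr_powr mult.commute flip: powr_realpow)
    then have "(\<Sum>j<N. c * 2 powr ups * (\<rho> * 2 ^ j) powr (ups - s))
        = c * 2 powr ups * \<rho> powr (ups - s) * (\<Sum>j<N. q ^ j)"
      by (simp add: sum_distrib_left mult.assoc)
    also have "\<dots> \<le> c * 2 powr ups * \<rho> powr (ups - s) * (1 / (1 - q))"
    proof (rule mult_left_mono)
      show "(\<Sum>j<N. q ^ j) \<le> 1 / (1 - q)"
        using sum_le_suminf[of "\<lambda>j. q ^ j" "{..<N}"] q by (simp add: suminf_geometric summable_geometric)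
    qed (use c_pos in auto)
    finally show "(\<Sum>j<N. c * 2 powr ups * (\<rho> * 2 ^ j) powr (ups - s))
      \<le> c * 2 powr ups / (1 - 2 powr (ups - s)) * \<rho> powr (ups - s)" by (simp add: q_def)
  qed
  finally show ?thesis .
qed

end

section \<open>Weakly singular kernels\<close>

text \<open>\<open>D\<close> exceeds every distance, so \<open>ball x D\<close> contains the whole
  space and potentials of radius \<open>D\<close> are global. The bound \<open>kernel_le\<close>
  leaves out the diagonal, a null set for each \<open>x\<close>.\<close>

locale weakly_singular_kernel = ahlfors_space +
  fixes K :: "'a \<Rightarrow> 'a \<Rightarrow> complex" and s1 C1 D :: real
  assumes dist_less: "\<And>x y. x \<in> space nu \<Longrightarrow> y \<in> space nu \<Longrightarrow> dist x y < D"
    and D_pos: "0 < D"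
    and kernel_measurable: "\<And>x. x \<in> space nu \<Longrightarrow> K x \<in> borel_measurable nu"
    and s1: "0 \<le> s1" "s1 < ups" and C1: "0 \<le> C1"
    and kernel_le: "\<And>x y. x \<in> space nu \<Longrightarrow> y \<in> space nu \<Longrightarrow> x \<noteq> y \<Longrightarrow>
      cmod (K x y) \<le> C1 * dist x y powr - s1"
begin

lemma kernel_nn_integral_le:
  assumes x: "x \<in> space nu" and [measurable]: "\<mu> \<in> borel_measurable nu"
  shows "(\<integral>\<^sup>+y. ennreal (cmod (K x y * \<mu> y)) \<partial>nu) \<le> ennreal C1 * riesz_integral s1 D (\<lambda>y. ennreal (cmod (\<mu> y))) x"
proof -
  have "(\<integral>\<^sup>+y. ennreal (cmod (K x y * \<mu> y)) \<partial>nu)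
    \<le> (\<integral>\<^sup>+y. ennreal C1 * (indicator (ball x D) y * ennreal (dist x y powr - s1) * ennreal (cmod (\<mu> y))) \<partial>nu)"
  proof (rule nn_integral_mono_AE)
    show "AE y in nu. ennreal (cmod (K x y * \<mu> y))
      \<le> ennreal C1 * (indicator (ball x D) y * ennreal (dist x y powr - s1) * ennreal (cmod (\<mu> y)))"
      using AE_neq_point[OF x] AE_space
    proof eventually_elim
      case (elim y)
      then have "cmod (K x y * \<mu> y) \<le> C1 * dist x y powr - s1 * cmod (\<mu> y)"
        using kernel_le[OF x, of y] by (simp add: norm_mult mult_right_mono)
      then show ?case
        using dist_less[OF x, of y] elim C1 by (simp flip: ennreal_mult add: ennreal_leI mult.assoc)
    qed
  qed
  also have "\<dots> = ennreal C1 * riesz_integral s1 D (\<lambda>y. ennreal (cmod (\<mu> y))) x"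
    unfolding riesz_integral_def by (rule nn_integral_cmult) measurable
  finally show ?thesis .
qed

lemma layer_op_le:
  assumes x: "x \<in> space nu" and [measurable]: "\<mu> \<in> borel_measurable nu"
  shows "ennreal (cmod (layer_op nu K \<mu> x)) \<le> ennreal C1 * riesz_integral s1 D (\<lambda>y. ennreal (cmod (\<mu> y))) x"
proof (cases "integrable nu (\<lambda>y. K x y * \<mu> y)")
  case True
  then have "ennreal (cmod (layer_op nu K \<mu> x)) \<le> (\<integral>\<^sup>+y. ennreal (cmod (K x y * \<mu> y)) \<partial>nu)"
    unfolding layer_op_def by (rule integral_norm_bound_ennreal)
  then show ?thesis using kernel_nn_integral_le[OF assms] by (rule order_trans)
next
  \<comment> \<open>The Bochner integral of a nonintegrable function is 0 by convention. The bound
    therefore applies before \<open>\<mu>\<close> is known to be bounded.\<close>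
  case False
  then show ?thesis by (simp add: layer_op_def not_integrable_integral_eq)
qed

text \<open>Outside \<open>ball x e\<close> the weight is at most \<open>e powr - s1\<close>, so
  that part costs only the L^1 norm. It becomes part of the constant term in the inequality for the
  solution.\<close>

lemma riesz_integral_split:
  assumes [measurable]: "f \<in> borel_measurable nu" and e: "0 < e"
  shows "riesz_integral s1 D f x \<le> riesz_integral s1 e f x + ennreal (e powr - s1) * (\<integral>\<^sup>+y. f y \<partial>nu)"
proof -
  have "riesz_integral s1 D f x
    \<le> (\<integral>\<^sup>+y. indicator (ball x e) y * ennreal (dist x y powr - s1) * f y + ennreal (e powr - s1) * f y \<partial>nu)"
    unfolding riesz_integral_def
  proof (rule nn_integral_mono)
    fix y
    show "indicator (ball x D) y * ennreal (dist x y powr - s1) * f y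
      \<le> indicator (ball x e) y * ennreal (dist x y powr - s1) * f y + ennreal (e powr - s1) * f y"
    proof (cases "dist x y < e")
      case True
      then show ?thesis by (auto split: split_indicator)
    next
      case False
      then have "dist x y powr - s1 \<le> e powr - s1" using e s1 by (intro powr_mono2') auto
      then have "ennreal (dist x y powr - s1) * f y \<le> ennreal (e powr - s1) * f y"
        by (intro mult_right_mono ennreal_leI) auto
      then show ?thesis using False by (auto split: split_indicator)
    qed
  qed
  also have "\<dots> = riesz_integral s1 e f x + ennreal (e powr - s1) * (\<integral>\<^sup>+y. f y \<partial>nu)"
    unfolding riesz_integral_def by (simp add: nn_integral_add nn_integral_cmult)
  finally show ?thesis .
qed

lemma solution_AE_bounded:
  assumes [measurable]: "\<mu> \<in> borel_measurable nu" and fin: "(\<integral>\<^sup>+y. ennreal (cmod (\<mu> y)) \<partial>nu) < \<infinity>"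
    and g: "\<And>x. x \<in> space nu \<Longrightarrow> cmod (g x) \<le> G" and G: "0 \<le> G"
    and eq: "AE x in nu. \<mu> x - layer_op nu K \<mu> x = g x"
  obtains B where "0 \<le> B" "AE x in nu. cmod (\<mu> x) \<le> B"
proof -
  \<comment> \<open>\<open>C1\<close> may vanish; \<open>C1 + 1\<close> gives a positive factor, for
    which \<open>e\<close> can be solved.\<close>
  have "0 < (C1 + 1) * riesz_const s1" using C1 riesz_const_pos[OF s1(2)] by simp
  then obtain e where e: "0 < e" "(C1 + 1) * riesz_const s1 * e powr (ups - s1) = 1 / 2"
    using ex_powr_mult_eq[of "ups - s1" _ "1 / 2"] s1 by auto
  have "C1 * (riesz_const s1 * e powr (ups - s1)) \<le> (C1 + 1) * (riesz_const s1 * e powr (ups - s1))"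
    using riesz_const_pos[OF s1(2)] by (intro mult_right_mono) auto
  then have small: "C1 * (riesz_const s1 * e powr (ups - s1)) \<le> 1 / 2"
    using e by (simp add: mult.assoc)
  obtain t where t: "0 \<le> t" "(\<integral>\<^sup>+y. ennreal (cmod (\<mu> y)) \<partial>nu) = ennreal t"
    using fin by (cases "\<integral>\<^sup>+y. ennreal (cmod (\<mu> y)) \<partial>nu") auto
  define G' where "G' = G + C1 * (e powr - s1 * t)"
  have G': "0 \<le> G'" using G C1 t by (simp add: G'_def)
  have "AE x in nu. ennreal (cmod (\<mu> x))
      \<le> ennreal G' + ennreal C1 * riesz_integral s1 e (\<lambda>y. ennreal (cmod (\<mu> y))) x"
    using eq AE_space
  proof eventually_elim
    case (elim x)
    let ?R = "\<lambda>e. riesz_integral s1 e (\<lambda>y. ennreal (cmod (\<mu> y))) x"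
    have "\<mu> x = g x + layer_op nu K \<mu> x" using elim(1) by (simp add: algebra_simps)
    then have "cmod (\<mu> x) \<le> G + cmod (layer_op nu K \<mu> x)"
      using g[OF elim(2)] norm_triangle_ineq[of "g x" "layer_op nu K \<mu> x"] by simp
    then have "ennreal (cmod (\<mu> x)) \<le> ennreal G + ennreal (cmod (layer_op nu K \<mu> x))"
      using G by (simp flip: ennreal_plus add: ennreal_leI)
    also have "\<dots> \<le> ennreal G + ennreal C1 * ?R D"
      using layer_op_le[OF elim(2), of \<mu>] by (intro add_left_mono) simp
    also have "\<dots> \<le> ennreal G + ennreal C1 * (?R e + ennreal (e powr - s1) * ennreal t)"
      using riesz_integral_split[of "\<lambda>y. ennreal (cmod (\<mu> y))" e x] e t
      by (intro add_left_mono mult_left_mono) auto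
    also have "\<dots> = (ennreal G + ennreal C1 * (ennreal (e powr - s1) * ennreal t)) + ennreal C1 * ?R e"
      by (simp add: distrib_left add_ac)
    also have "ennreal G + ennreal C1 * (ennreal (e powr - s1) * ennreal t) = ennreal G'"
      using G C1 t by (simp add: G'_def ennreal_mult ennreal_plus)
    finally show ?case .
  qed
  then have "AE x in nu. cmod (\<mu> x) \<le> 2 * G'"
    using AE_bounded_of_riesz_inequality[of "\<lambda>x. cmod (\<mu> x)" s1 e C1 G'] fin s1 e C1 G' small by simp
  then show thesis using that[of "2 * G'"] G' by simp
qed

section \<open>The operator on bounded densities\<close>

context
  fixes \<mu> :: "'a \<Rightarrow> complex" and B :: real
  assumes \<mu>_measurable [measurable]: "\<mu> \<in> borel_measurable nu"
    and B: "0 \<le> B" "AE y in nu. cmod (\<mu> y) \<le> B"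
begin

lemma riesz_integral_bounded_le:
  assumes x: "x \<in> space nu" and e: "0 < e"
  shows "riesz_integral s1 e (\<lambda>y. ennreal (cmod (\<mu> y))) x \<le> ennreal (B * (riesz_const s1 * e powr (ups - s1)))"
proof -
  have "riesz_integral s1 e (\<lambda>y. ennreal (cmod (\<mu> y))) x
    \<le> (\<integral>\<^sup>+y. ennreal B * (indicator (ball x e) y * ennreal (dist x y powr - s1) * 1) \<partial>nu)"
    unfolding riesz_integral_def
  proof (rule nn_integral_mono_AE)
    show "AE y in nu. indicator (ball x e) y * ennreal (dist x y powr - s1) * ennreal (cmod (\<mu> y))
      \<le> ennreal B * (indicator (ball x e) y * ennreal (dist x y powr - s1) * 1)"
      using B(2) by eventually_elim (simp add: mult.commute[of "ennreal B"] mult_left_mono ennreal_leI)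
  qed
  also have "\<dots> = ennreal B * riesz_integral s1 e (\<lambda>_. 1) x"
    unfolding riesz_integral_def by (rule nn_integral_cmult) measurable
  also have "\<dots> \<le> ennreal B * ennreal (riesz_const s1 * e powr (ups - s1))"
    by (intro mult_left_mono riesz_integral_1_le x s1 e) simp
  finally show ?thesis using B(1) by (simp add: ennreal_mult')
qed

lemma kernel_mult_integrable:
  assumes x: "x \<in> space nu"
  shows "integrable nu (\<lambda>y. K x y * \<mu> y)"
proof (rule integrableI_bounded)
  have [measurable]: "K x \<in> borel_measurable nu" by (rule kernel_measurable[OF x])
  show "(\<lambda>y. K x y * \<mu> y) \<in> borel_measurable nu" by measurable
  have "(\<integral>\<^sup>+y. ennreal (cmod (K x y * \<mu> y)) \<partial>nu) \<le> ennreal C1 * ennreal (B * (riesz_const s1 * D powr (ups - s1)))"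
    using kernel_nn_integral_le[OF x, of \<mu>] riesz_integral_bounded_le[OF x D_pos]
    by (meson \<mu>_measurable mult_left_mono order_trans zero_le)
  also have "\<dots> < \<infinity>" by (simp add: ennreal_mult_less_top)
  finally show "(\<integral>\<^sup>+y. ennreal (cmod (K x y * \<mu> y)) \<partial>nu) < \<infinity>" .
qed

lemma layer_op_bounded:
  assumes x: "x \<in> space nu"
  shows "cmod (layer_op nu K \<mu> x) \<le> C1 * (B * (riesz_const s1 * D powr (ups - s1)))"
proof -
  have "ennreal (cmod (layer_op nu K \<mu> x)) \<le> ennreal C1 * ennreal (B * (riesz_const s1 * D powr (ups - s1)))"
    using layer_op_le[OF x \<mu>_measurable] riesz_integral_bounded_le[OF x D_pos]
    by (meson mult_left_mono order_trans zero_le)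
  then show ?thesis
    using C1 B(1) riesz_const_pos[OF s1(2)] by (simp flip: ennreal_mult')
qed

text \<open>Within \<open>2 * dist x z\<close> of \<open>x\<close> cancellation is useless, so the
  two kernels are bounded separately; such points lie within \<open>3 * dist x z\<close> of
  \<open>z\<close>. Beyond that radius the difference condition on \<open>K\<close> applies. In the
  application \<open>L\<close> carries the factor \<open>dist x z powr s3\<close>.\<close>

lemma layer_op_diff_le:
  assumes x: "x \<in> space nu" and z: "z \<in> space nu" and ne: "x \<noteq> z" and L: "0 \<le> L"
    and diff: "\<And>y. y \<in> space nu \<Longrightarrow> 2 * dist x z \<le> dist x y \<Longrightarrow>
      cmod (K x y - K z y) \<le> L * dist x y powr - s2"
    and J: "0 \<le> J"
      "(\<integral>\<^sup>+y. indicator (- ball x (2 * dist x z)) y * ennreal (dist x y powr - s2) \<partial>nu) \<le> ennreal J"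
  shows "cmod (layer_op nu K \<mu> x - layer_op nu K \<mu> z)
    \<le> B * (C1 * (riesz_const s1 * (2 * dist x z) powr (ups - s1))
        + C1 * (riesz_const s1 * (3 * dist x z) powr (ups - s1)) + L * J)"
proof -
  define \<delta> where "\<delta> = dist x z"
  have \<delta>: "0 < \<delta>" using ne by (simp add: \<delta>_def)
  define P where "P e w y = indicator (ball w e) y * ennreal (dist w y powr - s1) * 1" for e and w y :: 'a
  define Q where "Q y = indicator (- ball x (2 * \<delta>)) y * ennreal (dist x y powr - s2)" for y
  have [measurable]: "P e w \<in> borel_measurable nu" for e w unfolding P_def by measurable
  have "(indicator (- ball x (2 * \<delta>)) :: 'a \<Rightarrow> ennreal) = (\<lambda>y. 1 - indicator (ball x (2 * \<delta>)) y)"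
    by (auto split: split_indicator)
  then have [measurable]: "Q \<in> borel_measurable nu" unfolding Q_def by simp
  have PI: "(\<integral>\<^sup>+y. P e w y \<partial>nu) \<le> ennreal (riesz_const s1 * e powr (ups - s1))"
    if "w \<in> space nu" "0 < e" for e w
    using riesz_integral_1_le[OF that(1) s1 that(2)] by (simp add: riesz_integral_def P_def)
  have QI: "(\<integral>\<^sup>+y. Q y \<partial>nu) \<le> ennreal J" using J(2) by (simp add: Q_def \<delta>_def)
  have int: "integrable nu (\<lambda>y. K x y * \<mu> y)" "integrable nu (\<lambda>y. K z y * \<mu> y)"
    using kernel_mult_integrable x z by auto
  have "ennreal (cmod (layer_op nu K \<mu> x - layer_op nu K \<mu> z))
      = ennreal (cmod (\<integral>y. K x y * \<mu> y - K z y * \<mu> y \<partial>nu))"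
    using int by (simp add: layer_op_def)
  also have "\<dots> \<le> (\<integral>\<^sup>+y. ennreal (cmod (K x y * \<mu> y - K z y * \<mu> y)) \<partial>nu)"
    using int by (intro integral_norm_bound_ennreal Bochner_Integration.integrable_diff)
  also have "\<dots> \<le> (\<integral>\<^sup>+y. ennreal B * (ennreal C1 * P (2 * \<delta>) x y + ennreal C1 * P (3 * \<delta>) z y + ennreal L * Q y) \<partial>nu)"
  proof (rule nn_integral_mono_AE)
    show "AE y in nu. ennreal (cmod (K x y * \<mu> y - K z y * \<mu> y))
      \<le> ennreal B * (ennreal C1 * P (2 * \<delta>) x y + ennreal C1 * P (3 * \<delta>) z y + ennreal L * Q y)"
      using B(2) AE_neq_point[OF x] AE_neq_point[OF z] AE_space
    proof eventually_elim
      case (elim y)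
      have "cmod (K x y * \<mu> y - K z y * \<mu> y) = cmod (\<mu> y) * cmod (K x y - K z y)"
        by (simp add: norm_mult[symmetric] algebra_simps)
      also have "\<dots> \<le> B * cmod (K x y - K z y)" using elim by (intro mult_right_mono) auto
      finally have *: "ennreal (cmod (K x y * \<mu> y - K z y * \<mu> y)) \<le> ennreal B * ennreal (cmod (K x y - K z y))"
        using B(1) by (simp flip: ennreal_mult add: ennreal_leI)
      have "ennreal (cmod (K x y - K z y))
        \<le> ennreal C1 * P (2 * \<delta>) x y + ennreal C1 * P (3 * \<delta>) z y + ennreal L * Q y"
      proof (cases "dist x y < 2 * \<delta>")
        case True
        then have "dist z y < 3 * \<delta>" using dist_triangle[of z y x] by (simp add: \<delta>_def dist_commute)
        have "cmod (K x y - K z y) \<le> C1 * dist x y powr - s1 + C1 * dist z y powr - s1"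
          using norm_triangle_ineq4[of "K x y" "K z y"] kernel_le[OF x, of y] kernel_le[OF z, of y] elim by force
        then have "ennreal (cmod (K x y - K z y)) \<le> ennreal C1 * P (2 * \<delta>) x y + ennreal C1 * P (3 * \<delta>) z y"
          using True \<open>dist z y < 3 * \<delta>\<close> C1
          by (simp add: P_def ennreal_leI flip: ennreal_mult ennreal_plus)
        then show ?thesis by (simp add: add_increasing2)
      next
        case False
        then have "ennreal (cmod (K x y - K z y)) \<le> ennreal L * Q y"
          using diff[of y] elim L by (simp add: Q_def \<delta>_def ennreal_leI flip: ennreal_mult)
        then show ?thesis by (simp add: add_increasing)
      qed
      then show ?case using * by (meson mult_left_mono order_trans zero_le)
    qed
  qed
  also have "\<dots> = ennreal B * (ennreal C1 * (\<integral>\<^sup>+y. P (2 * \<delta>) x y \<partial>nu) + ennreal C1 * (\<integral>\<^sup>+y. P (3 * \<delta>) z y \<partial>nu)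
      + ennreal L * (\<integral>\<^sup>+y. Q y \<partial>nu))"
    by (simp add: nn_integral_cmult nn_integral_add)
  also have "\<dots> \<le> ennreal B * (ennreal C1 * ennreal (riesz_const s1 * (2 * \<delta>) powr (ups - s1))
      + ennreal C1 * ennreal (riesz_const s1 * (3 * \<delta>) powr (ups - s1)) + ennreal L * ennreal J)"
    using PI[OF x, of "2 * \<delta>"] PI[OF z, of "3 * \<delta>"] QI \<delta> by (intro mult_left_mono add_mono) auto
  also have "\<dots> = ennreal (B * (C1 * (riesz_const s1 * (2 * \<delta>) powr (ups - s1))
        + C1 * (riesz_const s1 * (3 * \<delta>) powr (ups - s1)) + L * J))"
    using B(1) C1 L J(1) riesz_const_pos[OF s1(2)] by (simp add: ennreal_mult ennreal_plus)
  finally show ?thesis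
    using B(1) C1 L J(1) riesz_const_pos[OF s1(2)] by (simp add: \<delta>_def)
qed

end

end

section \<open>Moduli of continuity\<close>

text \<open>On bounded distances a smaller exponent absorbs a larger one; this is how the minima in
  \<open>varpi\<close> cover both near and far contributions.\<close>

lemma powr_le_const_mult_powr:
  fixes r D a b :: real
  assumes "0 < r" "r \<le> D" "b \<le> a"
  shows "r powr a \<le> D powr (a - b) * r powr b"
proof -
  have "r powr a = r powr (a - b) * r powr b" using assms by (simp flip: powr_add)
  also have "\<dots> \<le> D powr (a - b) * r powr b"
    using assms by (intro mult_right_mono powr_mono2) auto
  finally show ?thesis .
qed

lemma omega_log_nonneg: "0 < \<theta> \<Longrightarrow> 0 \<le> omega_log \<theta> r"
  by (simp add: omega_log_def)

text \<open>A crude bound for the limit at 0: the inequality \<open>ln t \<le> t - 1\<close> at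
  \<open>t = r powr (- \<theta> / 2)\<close> trades the logarithm for half of the power.\<close>

lemma omega_log_le_powr:
  assumes "0 < \<theta>" "0 < r"
  shows "omega_log \<theta> r \<le> 2 / \<theta> * r powr (\<theta> / 2)"
proof (cases "r \<le> exp (- 1 / \<theta>)")
  case True
  then have "r \<le> 1" using assms by (smt (verit) divide_neg_pos exp_le_one_iff)
  have "- ln r = 2 / \<theta> * ln (r powr (- \<theta> / 2))" using assms by (simp add: ln_powr)
  also have "\<dots> \<le> 2 / \<theta> * r powr (- \<theta> / 2)"
    using assms ln_le_minus_one[of "r powr (- \<theta> / 2)"] by (intro mult_left_mono) auto
  finally have "r powr \<theta> * \<bar>ln r\<bar> \<le> r powr \<theta> * (2 / \<theta> * r powr (- \<theta> / 2))"
    using assms \<open>r \<le> 1\<close> by (intro mult_left_mono) auto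
  also have "\<dots> = 2 / \<theta> * (r powr \<theta> * r powr (- \<theta> / 2))" by simp
  also have "r powr \<theta> * r powr (- \<theta> / 2) = r powr (\<theta> / 2)" using assms by (simp flip: powr_add)
  finally show ?thesis using True assms by (simp add: omega_log_def)
next
  case False
  then have "exp (- 1 / \<theta>) powr (\<theta> / 2) \<le> r powr (\<theta> / 2)" using assms by (intro powr_mono2) auto
  then have "exp (- 1 / 2) \<le> r powr (\<theta> / 2)" using assms by (simp add: powr_def)
  moreover have "exp (- 1) \<le> exp (- 1 / 2 :: real)" by simp
  ultimately have "exp (- 1) \<le> 2 * r powr (\<theta> / 2)"
    using powr_ge_zero[of r "\<theta> / 2"] by linarith
  then show ?thesis using False assms by (simp add: omega_log_def divide_right_mono)
qed

lemma powr_log_le_omega_log: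
  fixes D \<theta> :: real
  assumes D: "0 < D" and th: "0 < \<theta>" "\<theta> \<le> 1"
  obtains C where "0 \<le> C" "\<And>r. 0 < r \<Longrightarrow> r < D \<Longrightarrow> r powr \<theta> * (1 + log 2 (D / r)) \<le> C * omega_log \<theta> r"
proof
  define a where "a = 1 + \<bar>log 2 D\<bar>"
  \<comment> \<open>One entry per branch of \<open>omega_log\<close>. For small \<open>r\<close>,
    \<open>- ln r\<close> is at least 1 because \<open>\<theta> \<le> 1\<close>, and absorbs
    \<open>a\<close>. For large \<open>r\<close>, the left side is bounded and
    \<open>omega_log\<close> is constant; \<open>\<theta> * exp 1\<close> is the reciprocal of its
    value.\<close>
  define C where "C = max (a + 1 / ln 2) (D powr \<theta> * (a + 1 / (\<theta> * ln 2)) * (\<theta> * exp 1))"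
  have a: "1 \<le> a" by (simp add: a_def)
  show C0: "0 \<le> C" using a by (simp add: C_def max_def) (smt (verit) divide_nonneg_pos ln_gt_zero)
  fix r :: real assume r: "0 < r" "r < D"
  have log: "1 + log 2 (D / r) \<le> a + (- ln r) / ln 2"
    using r D by (simp add: a_def log_divide log_def[of 2 r])
  show "r powr \<theta> * (1 + log 2 (D / r)) \<le> C * omega_log \<theta> r"
  proof (cases "r \<le> exp (- 1 / \<theta>)")
    case True
    then have "ln r \<le> - 1 / \<theta>" using r by (metis ln_exp ln_le_cancel_iff exp_gt_zero)
    moreover have "1 \<le> 1 / \<theta>" using th by simp
    ultimately have ln1: "1 \<le> - ln r" by simp
    have "a \<le> a * (- ln r)" using mult_left_mono[OF ln1, of a] a by simp
    then have "1 + log 2 (D / r) \<le> (a + 1 / ln 2) * (- ln r)" using log by (simp add: algebra_simps)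
    also have "\<dots> \<le> C * \<bar>ln r\<bar>" using ln1 by (intro mult_mono) (use C0 in \<open>auto simp: C_def\<close>)
    finally have "r powr \<theta> * (1 + log 2 (D / r)) \<le> r powr \<theta> * (C * \<bar>ln r\<bar>)"
      by (intro mult_left_mono) auto
    then show ?thesis using True r by (simp add: omega_log_def mult_ac)
  next
    case False
    then have "- 1 / \<theta> < ln r" using r by (metis ln_exp ln_less_cancel_iff exp_gt_zero not_le)
    then have "- ln r / ln 2 \<le> (1 / \<theta>) / ln 2" by (intro divide_right_mono) auto
    then have "1 + log 2 (D / r) \<le> a + 1 / (\<theta> * ln 2)" using log by simp
    moreover have "0 \<le> 1 + log 2 (D / r)" using r D by (simp add: add_nonneg_nonneg)
    ultimately have "r powr \<theta> * (1 + log 2 (D / r)) \<le> D powr \<theta> * (a + 1 / (\<theta> * ln 2))"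
      using r th by (intro mult_mono powr_mono2) auto
    also have "\<dots> = D powr \<theta> * (a + 1 / (\<theta> * ln 2)) * (\<theta> * exp 1) * omega_log \<theta> r"
      using False r th by (simp add: omega_log_def exp_minus)
    also have "\<dots> \<le> C * omega_log \<theta> r"
      using omega_log_nonneg[OF th(1)] by (intro mult_right_mono) (auto simp: C_def)
    finally show ?thesis .
  qed
qed

lemma powr_tendsto_0_at_right:
  fixes a :: real
  assumes "0 < a"
  shows "((\<lambda>r::real. r powr a) \<longlongrightarrow> 0) (at_right 0)"
proof (rule tendsto_zero_powrI)
  show "eventually (\<lambda>r::real. 0 \<le> r) (at_right 0)"
    using eventually_at_right_less[of "0::real"] by eventually_elim simp
qed (use assms in \<open>auto intro: tendsto_intros\<close>)

lemma omega_log_tendsto_0: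
  assumes "0 < \<theta>"
  shows "(omega_log \<theta> \<longlongrightarrow> 0) (at_right 0)"
proof (rule tendsto_sandwich)
  show "((\<lambda>_. 0) \<longlongrightarrow> (0::real)) (at_right (0::real))" by simp
  show "eventually (\<lambda>r. 0 \<le> omega_log \<theta> r) (at_right 0)"
    using omega_log_nonneg[OF assms] by simp
  show "((\<lambda>r. 2 / \<theta> * r powr (\<theta> / 2)) \<longlongrightarrow> 0) (at_right 0)"
    using assms by (intro tendsto_mult_right_zero powr_tendsto_0_at_right) simp
  show "eventually (\<lambda>r. omega_log \<theta> r \<le> 2 / \<theta> * r powr (\<theta> / 2)) (at_right 0)"
    using eventually_at_right_less[of 0] by eventually_elim (rule omega_log_le_powr[OF assms])
qed

lemma varpi_tendsto_0:
  assumes "s1 < ups" "0 < s3" "ups < s2 \<Longrightarrow> s2 < ups + s3"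
  shows "(varpi ups s1 s2 s3 \<longlongrightarrow> 0) (at_right 0)"
proof -
  have eq: "eventually (\<lambda>r. F r = varpi ups s1 s2 s3 r) (at_right 0)"
    if "\<And>r. 0 < r \<Longrightarrow> F r = varpi ups s1 s2 s3 r" for F
    using eventually_at_right_less[of "0::real"] by eventually_elim (rule that)
  consider "s2 < ups" | "s2 = ups" | "ups < s2" by linarith
  then show ?thesis
  proof cases
    case 1
    then have "((\<lambda>r. r powr (min (ups - s1) s3)) \<longlongrightarrow> 0) (at_right 0)"
      using assms by (intro powr_tendsto_0_at_right) auto
    then show ?thesis by (rule Lim_transform_eventually[OF _ eq]) (use 1 in \<open>simp add: varpi_def\<close>)
  next
    case 2
    then have "((\<lambda>r. max (r powr (ups - s1)) (omega_log s3 r)) \<longlongrightarrow> max 0 0) (at_right 0)"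
      using assms by (intro tendsto_max powr_tendsto_0_at_right omega_log_tendsto_0) auto
    then have "((\<lambda>r. max (r powr (ups - s1)) (omega_log s3 r)) \<longlongrightarrow> 0) (at_right 0)" by simp
    then show ?thesis by (rule Lim_transform_eventually[OF _ eq]) (use 2 in \<open>simp add: varpi_def\<close>)
  next
    case 3
    then have "((\<lambda>r. r powr (min (ups - s1) (s3 + ups - s2))) \<longlongrightarrow> 0) (at_right 0)"
      using assms by (intro powr_tendsto_0_at_right) auto
    then show ?thesis by (rule Lim_transform_eventually[OF _ eq]) (use 3 in \<open>simp add: varpi_def\<close>)
  qed
qed

lemma continuous_on_of_modulus:
  fixes f :: "'a::metric_space \<Rightarrow> 'b::metric_space"
  assumes lim: "(\<omega> \<longlongrightarrow> 0) (at_right 0)"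
    and le: "\<And>x y. x \<in> Y \<Longrightarrow> y \<in> Y \<Longrightarrow> x \<noteq> y \<Longrightarrow> dist (f x) (f y) \<le> C * \<omega> (dist x y)"
  shows "continuous_on Y f"
  unfolding continuous_on_def
proof
  fix x assume x: "x \<in> Y"
  have "filterlim (\<lambda>y. dist x y) (at_right 0) (at x within Y)"
    unfolding filterlim_at by (intro conjI tendsto_eq_intros) (auto simp: eventually_at_filter)
  then have "((\<lambda>y. C * \<omega> (dist x y)) \<longlongrightarrow> 0) (at x within Y)"
    by (intro tendsto_mult_right_zero filterlim_compose[OF lim])
  moreover have "eventually (\<lambda>y. dist (f y) (f x) \<le> C * \<omega> (dist x y)) (at x within Y)"
    using le[OF x] by (auto simp: eventually_at_filter dist_commute)
  ultimately have "((\<lambda>y. dist (f y) (f x)) \<longlongrightarrow> 0) (at x within Y)"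
    using tendsto_sandwich[OF _ _ tendsto_const[of 0], of "\<lambda>y. dist (f y) (f x)" "at x within Y"
        "\<lambda>y. C * \<omega> (dist x y)"] by simp
  then show "(f \<longlongrightarrow> f x) (at x within Y)" using tendsto_dist_iff by blast
qed

text \<open>\<open>layer_op_diff_le\<close> leaves two quantities to compare with
  \<open>varpi\<close>: \<open>\<delta> powr (ups - s1)\<close> from the near part, and
  \<open>\<delta> powr s3\<close> times the far integral. The facts \<open>near\<close> and
  \<open>far\<close> do this with constants uniform in the points.\<close>

lemma (in weakly_singular_kernel) layer_op_modulus:
  assumes [measurable]: "\<mu> \<in> borel_measurable nu" and B: "0 \<le> B" "AE y in nu. cmod (\<mu> y) \<le> B"
    and s: "0 \<le> s2" "0 < s3" "s3 \<le> 1" "ups < s2 \<Longrightarrow> s2 < ups + s3" and C2: "0 \<le> C2"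
    and diff: "\<And>x z y. x \<in> space nu \<Longrightarrow> z \<in> space nu \<Longrightarrow> y \<in> space nu \<Longrightarrow> x \<noteq> z \<Longrightarrow>
      2 * dist x z \<le> dist x y \<Longrightarrow> cmod (K x y - K z y) \<le> C2 * dist x z powr s3 * dist x y powr - s2"
  obtains C where "0 \<le> C" "\<And>x z. x \<in> space nu \<Longrightarrow> z \<in> space nu \<Longrightarrow> x \<noteq> z \<Longrightarrow>
    cmod (layer_op nu K \<mu> x - layer_op nu K \<mu> z) \<le> C * varpi ups s1 s2 s3 (dist x z)"
proof -
  have near: "\<exists>A\<ge>0. \<forall>\<delta>. 0 < \<delta> \<longrightarrow> \<delta> < D \<longrightarrow> \<delta> powr (ups - s1) \<le> A * varpi ups s1 s2 s3 \<delta>"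
  proof (cases "s2 = ups")
    case True
    then show ?thesis by (intro exI[of _ 1]) (auto simp: varpi_def)
  next
    case False
    define m where "m = (if s2 < ups then min (ups - s1) s3 else min (ups - s1) (s3 + ups - s2))"
    have "\<delta> powr (ups - s1) \<le> D powr (ups - s1 - m) * varpi ups s1 s2 s3 \<delta>" if "0 < \<delta>" "\<delta> < D" for \<delta>
      using powr_le_const_mult_powr[of \<delta> D m "ups - s1"] that False by (auto simp: m_def varpi_def)
    then show ?thesis by (intro exI[of _ "D powr (ups - s1 - m)"]) auto
  qed
  have far: "\<exists>A\<ge>0. \<forall>x\<in>space nu. \<forall>\<delta>. 0 < \<delta> \<longrightarrow> \<delta> < D \<longrightarrow> (\<exists>J\<ge>0.
      (\<integral>\<^sup>+y. indicator (- ball x (2 * \<delta>)) y * ennreal (dist x y powr - s2) \<partial>nu) \<le> ennreal J \<and>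
      \<delta> powr s3 * J \<le> A * varpi ups s1 s2 s3 \<delta>)"
  proof -
    consider "s2 < ups" | "s2 = ups" | "ups < s2" by linarith
    then show ?thesis
    proof cases
      case 1
      define J where "J = riesz_const s2 * D powr (ups - s2)"
      have J: "0 \<le> J" using riesz_const_pos[OF 1] by (simp add: J_def)
      define m where "m = min (ups - s1) s3"
      have "\<delta> powr s3 * J \<le> (D powr (s3 - m) * J) * varpi ups s1 s2 s3 \<delta>" if "0 < \<delta>" "\<delta> < D" for \<delta>
        using mult_right_mono[OF powr_le_const_mult_powr[of \<delta> D m s3] J] that 1
        by (auto simp: m_def varpi_def mult_ac)
      then show ?thesis
        using far_integral_subcritical[OF _ s(1) 1 dist_less] J
        by (intro exI[of _ "D powr (s3 - m) * J"]) (auto simp: J_def)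
    next
      case 2
      obtain A where A: "0 \<le> A" "\<And>r. 0 < r \<Longrightarrow> r < D \<Longrightarrow> r powr s3 * (1 + log 2 (D / r)) \<le> A * omega_log s3 r"
        using powr_log_le_omega_log[OF D_pos s(2,3)] by blast
      have "\<exists>J\<ge>0. (\<integral>\<^sup>+y. indicator (- ball x (2 * \<delta>)) y * ennreal (dist x y powr - s2) \<partial>nu) \<le> ennreal J \<and>
          \<delta> powr s3 * J \<le> (c * 2 powr ups * A) * varpi ups s1 s2 s3 \<delta>"
        if x: "x \<in> space nu" and \<delta>: "0 < \<delta>" "\<delta> < D" for x \<delta>
      proof (intro exI conjI)
        show "0 \<le> c * 2 powr ups * (1 + log 2 (D / \<delta>))"
          using \<delta> c_pos by (auto intro!: mult_nonneg_nonneg add_nonneg_nonneg)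
        show "(\<integral>\<^sup>+y. indicator (- ball x (2 * \<delta>)) y * ennreal (dist x y powr - s2) \<partial>nu)
            \<le> ennreal (c * 2 powr ups * (1 + log 2 (D / \<delta>)))"
          using far_integral_critical[OF x dist_less[OF x], of "2 * \<delta>"] \<delta> 2 by simp
        have "\<delta> powr s3 * (c * 2 powr ups * (1 + log 2 (D / \<delta>)))
            = c * 2 powr ups * (\<delta> powr s3 * (1 + log 2 (D / \<delta>)))" by simp
        also have "\<dots> \<le> c * 2 powr ups * (A * omega_log s3 \<delta>)"
          using A(2)[OF \<delta>] c_pos by (intro mult_left_mono) auto
        also have "\<dots> \<le> c * 2 powr ups * (A * varpi ups s1 s2 s3 \<delta>)"
          using A(1) c_pos 2 \<delta> by (intro mult_left_mono) (auto simp: varpi_def)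
        finally show "\<delta> powr s3 * (c * 2 powr ups * (1 + log 2 (D / \<delta>)))
            \<le> (c * 2 powr ups * A) * varpi ups s1 s2 s3 \<delta>" by simp
      qed
      then show ?thesis using A(1) c_pos by (intro exI[of _ "c * 2 powr ups * A"]) auto
    next
      case 3
      \<comment> \<open>The last factor comes from taking \<open>\<rho> = 2 * \<delta>\<close> in
        the far integral.\<close>
      define b where "b = c * 2 powr ups / (1 - 2 powr (ups - s2)) * 2 powr (ups - s2)"
      have b: "0 \<le> b" using c_pos 3 by (simp add: b_def less_imp_le powr_less_one)
      define m where "m = min (ups - s1) (s3 + ups - s2)"
      have "\<exists>J\<ge>0. (\<integral>\<^sup>+y. indicator (- ball x (2 * \<delta>)) y * ennreal (dist x y powr - s2) \<partial>nu) \<le> ennreal J \<and>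
          \<delta> powr s3 * J \<le> (b * D powr (s3 + ups - s2 - m)) * varpi ups s1 s2 s3 \<delta>"
        if x: "x \<in> space nu" and \<delta>: "0 < \<delta>" "\<delta> < D" for x \<delta>
      proof (intro exI conjI)
        show "0 \<le> b * \<delta> powr (ups - s2)" using b by simp
        show "(\<integral>\<^sup>+y. indicator (- ball x (2 * \<delta>)) y * ennreal (dist x y powr - s2) \<partial>nu)
            \<le> ennreal (b * \<delta> powr (ups - s2))"
          using far_integral_supercritical[OF x dist_less[OF x], of "2 * \<delta>" s2] \<delta> 3
          by (simp add: b_def powr_mult mult.assoc)
        have "\<delta> powr s3 * (b * \<delta> powr (ups - s2)) = b * \<delta> powr (s3 + ups - s2)"
          using \<delta> by (simp add: powr_add[of \<delta> s3 "ups - s2"] flip: add_diff_eq)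
        also have "\<dots> \<le> b * (D powr (s3 + ups - s2 - m) * \<delta> powr m)"
          using powr_le_const_mult_powr[of \<delta> D m "s3 + ups - s2"] \<delta> b
          by (intro mult_left_mono) (auto simp: m_def)
        finally show "\<delta> powr s3 * (b * \<delta> powr (ups - s2))
            \<le> (b * D powr (s3 + ups - s2 - m)) * varpi ups s1 s2 s3 \<delta>"
          using 3 \<delta> by (simp add: varpi_def m_def)
      qed
      then show ?thesis using b by (intro exI[of _ "b * D powr (s3 + ups - s2 - m)"]) auto
    qed
  qed
  from near obtain A1 where A1: "0 \<le> A1"
    "\<And>\<delta>. 0 < \<delta> \<Longrightarrow> \<delta> < D \<Longrightarrow> \<delta> powr (ups - s1) \<le> A1 * varpi ups s1 s2 s3 \<delta>" by blast
  from far obtain A2 where A2: "0 \<le> A2"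
    "\<And>x \<delta>. x \<in> space nu \<Longrightarrow> 0 < \<delta> \<Longrightarrow> \<delta> < D \<Longrightarrow> (\<exists>J\<ge>0.
      (\<integral>\<^sup>+y. indicator (- ball x (2 * \<delta>)) y * ennreal (dist x y powr - s2) \<partial>nu) \<le> ennreal J \<and>
      \<delta> powr s3 * J \<le> A2 * varpi ups s1 s2 s3 \<delta>)" by blast
  \<comment> \<open>The powers of 2 and 3 come from the near radii \<open>2 * \<delta>\<close> and
    \<open>3 * \<delta>\<close>.\<close>
  define R where "R = C1 * riesz_const s1 * (2 powr (ups - s1) + 3 powr (ups - s1))"
  have R: "0 \<le> R" using C1 riesz_const_pos[OF s1(2)] by (simp add: R_def)
  show thesis
  proof
    show "0 \<le> B * (R * A1 + C2 * A2)" using B R A1 A2 C2 by simp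
    fix x z assume x: "x \<in> space nu" and z: "z \<in> space nu" and ne: "x \<noteq> z"
    define \<delta> where "\<delta> = dist x z"
    define V where "V = varpi ups s1 s2 s3 \<delta>"
    have \<delta>: "0 < \<delta>" "\<delta> < D" using ne dist_less[OF x z] by (auto simp: \<delta>_def)
    obtain J where J: "0 \<le> J"
      "(\<integral>\<^sup>+y. indicator (- ball x (2 * \<delta>)) y * ennreal (dist x y powr - s2) \<partial>nu) \<le> ennreal J"
      "\<delta> powr s3 * J \<le> A2 * V" using A2(2)[OF x \<delta>] by (auto simp: V_def)
    have "cmod (layer_op nu K \<mu> x - layer_op nu K \<mu> z)
      \<le> B * (C1 * (riesz_const s1 * (2 * dist x z) powr (ups - s1))
        + C1 * (riesz_const s1 * (3 * dist x z) powr (ups - s1)) + C2 * dist x z powr s3 * J)"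
      using diff[OF x z _ ne] C2 J
      by (intro layer_op_diff_le[OF \<open>\<mu> \<in> borel_measurable nu\<close> B x z ne]) (auto simp: \<delta>_def)
    also have "\<dots> = B * (R * \<delta> powr (ups - s1) + C2 * (\<delta> powr s3 * J))"
      using \<delta> by (simp add: R_def \<delta>_def[symmetric] powr_mult algebra_simps)
    also have "\<dots> \<le> B * (R * (A1 * V) + C2 * (A2 * V))"
      using A1(2)[OF \<delta>] J(3) R C2 B by (intro mult_left_mono add_mono) (auto simp: V_def)
    finally show "cmod (layer_op nu K \<mu> x - layer_op nu K \<mu> z)
        \<le> B * (R * A1 + C2 * A2) * varpi ups s1 s2 s3 (dist x z)"
      by (simp add: V_def \<delta>_def algebra_simps)
  qed
qed

section \<open>From the hypotheses on \<open>Y\<close> to the locales, and the conclusion\<close>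

text \<open>Above a fixed radius \<open>\<rho>\<close> the total mass \<open>t\<close> is itself at
  most \<open>t / \<rho> powr ups * r powr ups\<close>, so enlarging the constant removes the
  threshold.\<close>

lemma upper_ahlfors_regular_global:
  fixes nu :: "'a::metric_space measure"
  assumes reg: "upper_ahlfors_regular nu Y ups" and Y: "space nu = Y"
    and fin: "emeasure nu Y < \<infinity>" and ups: "0 < ups"
  obtains c where "0 < c" "\<And>x r. x \<in> Y \<Longrightarrow> 0 < r \<Longrightarrow>
    emeasure nu (ball x r \<inter> Y) \<le> ennreal (c * r powr ups)"
proof -
  obtain r0 :: ereal and c0 :: real where r0: "0 < r0" and c0: "0 < c0"
    and le: "\<And>x r. x \<in> Y \<Longrightarrow> 0 < r \<Longrightarrow> ereal r < r0 \<Longrightarrow>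
      emeasure nu (ball x r \<inter> Y) \<le> ennreal (c0 * r powr ups)"
    using reg unfolding upper_ahlfors_regular_def by blast
  \<comment> \<open>\<open>r0\<close> may be infinite, so a real radius below it is chosen.\<close>
  obtain \<rho> where \<rho>: "0 < \<rho>" "ereal \<rho> < r0"
    using ereal_dense2[OF r0] by (auto simp: zero_ereal_def)
  obtain t where t: "0 \<le> t" "emeasure nu Y = ennreal t" using fin by (cases "emeasure nu Y") auto
  show thesis
  proof
    show "0 < c0 + t / \<rho> powr ups" using c0 t \<rho> by (intro add_pos_nonneg) auto
    fix x r assume x: "x \<in> Y" and r: "(0::real) < r"
    show "emeasure nu (ball x r \<inter> Y) \<le> ennreal ((c0 + t / \<rho> powr ups) * r powr ups)"
    proof (cases "r \<le> \<rho>")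
      case True
      then have "ereal r < r0" using \<rho>(2) by (meson ereal_less_eq(3) order_le_less_trans)
      then have "emeasure nu (ball x r \<inter> Y) \<le> ennreal (c0 * r powr ups)" using le[OF x r] by simp
      also have "\<dots> \<le> ennreal ((c0 + t / \<rho> powr ups) * r powr ups)"
        using t by (intro ennreal_leI mult_right_mono) auto
      finally show ?thesis .
    next
      case False
      have "emeasure nu (ball x r \<inter> Y) \<le> emeasure nu (space nu)" by (rule emeasure_space)
      also have "\<dots> = ennreal (t / \<rho> powr ups * \<rho> powr ups)" using t \<rho> Y by simp
      also have "\<dots> \<le> ennreal ((c0 + t / \<rho> powr ups) * r powr ups)"
        using t c0 False \<rho> ups by (intro ennreal_leI mult_mono powr_mono2) auto
      finally show ?thesis .
    qed
  qed
qed

lemma finite_nn_integral_of_square_integrable: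
  fixes f :: "'a \<Rightarrow> 'b::{real_normed_vector, second_countable_topology}"
  assumes [measurable]: "f \<in> borel_measurable M" and "emeasure M (space M) < \<infinity>"
    and "integrable M (\<lambda>x. (norm (f x))\<^sup>2)"
  shows "(\<integral>\<^sup>+x. ennreal (norm (f x)) \<partial>M) < \<infinity>"
proof -
  have "t \<le> 1 + t\<^sup>2" for t :: real
    using zero_le_power2[of "t - 1 / 2"] by (simp add: power2_eq_square algebra_simps)
  then have "(\<integral>\<^sup>+x. ennreal (norm (f x)) \<partial>M) \<le> (\<integral>\<^sup>+x. 1 + ennreal ((norm (f x))\<^sup>2) \<partial>M)"
    by (intro nn_integral_mono) (simp flip: ennreal_plus ennreal_1 add: ennreal_leI)
  also have "\<dots> = emeasure M (space M) + (\<integral>\<^sup>+x. ennreal ((norm (f x))\<^sup>2) \<partial>M)"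
    by (simp add: nn_integral_add)
  also have "\<dots> < \<infinity>" using assms(2,3) by (auto simp: integrable_iff_bounded)
  finally show ?thesis .
qed

theorem theorem6p1:
  fixes Y :: "'a::metric_space set" and nu :: "'a measure"
    and ups \<theta> s1 s2 s3 :: real
    and K :: "'a \<Rightarrow> 'a \<Rightarrow> complex" and g \<mu> :: "'a \<Rightarrow> complex"
  assumes "bounded Y"
    and "space nu = Y"
    and "sets (restrict_space borel Y) \<subseteq> sets nu"
    and "\<forall>x\<in>Y. \<forall>r>0. emeasure nu (ball x r \<inter> Y) < \<infinity>"
    and "0 < ups"
    and "upper_ahlfors_regular nu Y ups"
    and "0 < \<theta>" "\<theta> \<le> 1"
    and "0 \<le> s1" "ups - 1 \<le> s1" "s1 < ups"
    and "0 \<le> s2"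
    and "0 < s3" "s3 \<le> 1"
    and "s2 = ups \<Longrightarrow> strongly_upper_ahlfors_regular nu Y ups"
    and "s2 > ups \<Longrightarrow> s2 < ups + s3"
    and "kernel_class s1 s2 s3 Y K"
    and "holder_space (\<lambda>r. r powr \<theta>) Y g"
    and "\<mu> \<in> borel_measurable nu"
    and "integrable nu (\<lambda>y. (cmod (\<mu> y))\<^sup>2)"
    and "AE x in nu. \<mu> x - layer_op nu K \<mu> x = g x"
  shows "\<exists>f. holder_space (\<lambda>r. max (r powr \<theta>) (varpi ups s1 s2 s3 r)) Y f
             \<and> (AE x in nu. \<mu> x = f x)"
proof (cases "Y = {}")
  case True
  then have "AE x in nu. \<mu> x = g x" using assms(2) by (intro AE_I2) auto
  then show ?thesis using True by (intro exI[of _ g]) (auto simp: holder_space_def)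
next
  case False
  \<comment> \<open>The base point yields finite total mass: \<open>Y\<close> equals its
    intersection with \<open>ball x0 D\<close>.\<close>
  then obtain x0 where x0: "x0 \<in> Y" by blast
  obtain D where D: "0 < D" "\<And>x y. x \<in> Y \<Longrightarrow> y \<in> Y \<Longrightarrow> dist x y < D"
  proof -
    obtain e where e: "\<And>x y. x \<in> Y \<Longrightarrow> y \<in> Y \<Longrightarrow> dist x y \<le> e"
      using \<open>bounded Y\<close> unfolding bounded_two_points by blast
    moreover have "0 \<le> e" using e[OF x0 x0] by simp
    ultimately show thesis using that[of "e + 1"] by (smt (verit))
  qed
  have "ball x0 D \<inter> Y = Y" using D(2)[OF x0] by auto
  then have fin: "emeasure nu Y < \<infinity>" using assms(4) x0 D(1) by metis
  obtain c where c: "0 < c" "\<And>x r. x \<in> Y \<Longrightarrow> 0 < r \<Longrightarrow> emeasure nu (ball x r \<inter> Y) \<le> ennreal (c * r powr ups)"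
    by (rule upper_ahlfors_regular_global[OF assms(6,2) fin assms(5)], rule that) blast+
  interpret ahlfors_space nu ups c
  proof
    show "sets (restrict_space borel (space nu)) \<subseteq> sets nu" using assms(3) by (simp only: assms(2))
    show "0 < ups" "0 < c" by (fact assms(5) c(1))+
    show "emeasure nu (ball x r \<inter> space nu) \<le> ennreal (c * r powr ups)"
      if "x \<in> space nu" "0 < r" for x r using c(2) that by (simp only: assms(2))
  qed
  note kernel = \<open>kernel_class s1 s2 s3 Y K\<close>[unfolded kernel_class_def]
  note cont = kernel[THEN conjunct1]
  obtain C1' where C1': "\<forall>x\<in>Y. \<forall>y\<in>Y. x \<noteq> y \<longrightarrow> dist x y powr s1 * cmod (K x y) \<le> C1'"
    using kernel[THEN conjunct2, THEN conjunct1] by (elim exE)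
  obtain C2' where C2': "\<forall>x'\<in>Y. \<forall>x''\<in>Y. \<forall>y\<in>Y - ball x' (2 * dist x' x''). x' \<noteq> x'' \<longrightarrow>
      dist x' y powr s2 / dist x' x'' powr s3 * cmod (K x' y - K x'' y) \<le> C2'"
    using kernel[THEN conjunct2, THEN conjunct2] by (elim exE)
  \<comment> \<open>The given upper bounds may be negative when no admissible pair exists, as for a
    singleton \<open>Y\<close>; the estimates want nonnegative constants.\<close>
  define C1 C2 where "C1 = max 0 C1'" and "C2 = max 0 C2'"
  interpret weakly_singular_kernel nu ups c K s1 C1 D
  proof
    show "dist x y < D" if "x \<in> space nu" "y \<in> space nu" for x y using D(2) that assms(2) by simp
    show "0 < D" "0 \<le> s1" "s1 < ups" "0 \<le> C1" using D(1) assms by (auto simp: C1_def)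
    show "K x \<in> borel_measurable nu" if "x \<in> space nu" for x
    proof (rule borel_measurable_continuous_off_point)
      have "continuous_on (space nu - {x}) ((\<lambda>(x, y). K x y) \<circ> (\<lambda>y. (x, y)))"
        using that assms(2)
        by (intro continuous_on_compose continuous_intros continuous_on_subset[OF cont]) auto
      then show "continuous_on (space nu - {x}) (K x)" by (simp add: o_def)
    qed
    show "cmod (K x y) \<le> C1 * dist x y powr - s1" if "x \<in> space nu" "y \<in> space nu" "x \<noteq> y" for x y
    proof -
      have "dist x y powr s1 * cmod (K x y) \<le> C1'"
        using C1'[rule_format, of x y] that assms(2) by simp
      then have "dist x y powr s1 * cmod (K x y) \<le> C1" by (simp add: C1_def)
      then show ?thesis using that by (simp add: powr_minus field_simps)
    qed
  qed
  note holder = \<open>holder_space (\<lambda>r. r powr \<theta>) Y g\<close>[unfolded holder_space_def]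
  note gbd = holder[THEN conjunct1]
  obtain Cg where Cg: "\<forall>x\<in>Y. \<forall>y\<in>Y. x \<noteq> y \<longrightarrow> cmod (g x - g y) / dist x y powr \<theta> \<le> Cg"
    using holder[THEN conjunct2, THEN conjunct2] by (elim exE)
  obtain G where G: "0 < G" "\<And>x. x \<in> Y \<Longrightarrow> cmod (g x) \<le> G"
    using gbd unfolding bounded_pos by auto
  have L1: "(\<integral>\<^sup>+y. ennreal (cmod (\<mu> y)) \<partial>nu) < \<infinity>"
    using finite_nn_integral_of_square_integrable[of \<mu> nu] assms(2) fin
      \<open>\<mu> \<in> borel_measurable nu\<close> \<open>integrable nu (\<lambda>y. (cmod (\<mu> y))\<^sup>2)\<close> by simp
  obtain B where B: "0 \<le> B" "AE x in nu. cmod (\<mu> x) \<le> B"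
    using solution_AE_bounded[OF \<open>\<mu> \<in> borel_measurable nu\<close> L1, of g G] G assms(2)
      \<open>AE x in nu. \<mu> x - layer_op nu K \<mu> x = g x\<close> by auto
  have C2: "cmod (K x y - K z y) \<le> C2 * dist x z powr s3 * dist x y powr - s2"
    if "x \<in> space nu" "z \<in> space nu" "y \<in> space nu" "x \<noteq> z" "2 * dist x z \<le> dist x y" for x z y
  proof -
    have "0 < dist x y" using that by (smt (verit) zero_less_dist_iff)
    moreover have "dist x y powr s2 / dist x z powr s3 * cmod (K x y - K z y) \<le> C2"
      using C2'[rule_format, of x z y] that assms(2) by (simp add: C2_def)
    ultimately show ?thesis using that by (simp add: powr_minus field_simps)
  qed
  have "0 \<le> C2" by (simp add: C2_def)
  obtain CA where CA: "0 \<le> CA" "\<And>x z. x \<in> Y \<Longrightarrow> z \<in> Y \<Longrightarrow> x \<noteq> z \<Longrightarrow>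
      cmod (layer_op nu K \<mu> x - layer_op nu K \<mu> z) \<le> CA * varpi ups s1 s2 s3 (dist x z)"
    using layer_op_modulus[OF \<open>\<mu> \<in> borel_measurable nu\<close> B \<open>0 \<le> s2\<close> \<open>0 < s3\<close> \<open>s3 \<le> 1\<close> assms(16) \<open>0 \<le> C2\<close> C2]
      assms(2) by auto
  \<comment> \<open>The right side is defined at every point, so the estimates for \<open>f\<close>
    hold everywhere; only its equality with \<open>\<mu>\<close> is almost everywhere.\<close>
  define f where "f x = g x + layer_op nu K \<mu> x" for x
  define w where "w r = max (r powr \<theta>) (varpi ups s1 s2 s3 r)" for r
  have mod_f: "cmod (f x - f y) \<le> (max 0 Cg + CA) * w (dist x y)"
    if x: "x \<in> Y" and y: "y \<in> Y" and ne: "x \<noteq> y" for x y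
  proof -
    have "cmod (g x - g y) \<le> max 0 Cg * dist x y powr \<theta>"
    proof -
      have "cmod (g x - g y) / dist x y powr \<theta> \<le> max 0 Cg"
        using Cg[rule_format, OF x y ne] by simp
      then show ?thesis using ne by (simp add: divide_le_eq)
    qed
    also have "\<dots> \<le> max 0 Cg * w (dist x y)" by (intro mult_left_mono) (auto simp: w_def)
    finally have 1: "cmod (g x - g y) \<le> max 0 Cg * w (dist x y)" .
    have "cmod (layer_op nu K \<mu> x - layer_op nu K \<mu> y) \<le> CA * varpi ups s1 s2 s3 (dist x y)"
      by (rule CA(2)[OF x y ne])
    also have "\<dots> \<le> CA * w (dist x y)" using CA(1) by (intro mult_left_mono) (auto simp: w_def)
    finally have 2: "cmod (layer_op nu K \<mu> x - layer_op nu K \<mu> y) \<le> CA * w (dist x y)" .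
    have "f x - f y = (g x - g y) + (layer_op nu K \<mu> x - layer_op nu K \<mu> y)" by (simp add: f_def)
    then have "cmod (f x - f y) \<le> cmod (g x - g y) + cmod (layer_op nu K \<mu> x - layer_op nu K \<mu> y)"
      by (metis norm_triangle_ineq)
    then show ?thesis using 1 2 by (simp add: distrib_right)
  qed
  have "bounded (f ` Y)"
  proof (rule boundedI)
    fix v assume "v \<in> f ` Y"
    then obtain x where x: "x \<in> Y" "v = f x" by blast
    then show "norm v \<le> G + C1 * (B * (riesz_const s1 * D powr (ups - s1)))"
      using G(2)[of x] layer_op_bounded[OF \<open>\<mu> \<in> borel_measurable nu\<close> B, of x] assms(2)
        norm_triangle_ineq[of "g x" "layer_op nu K \<mu> x"] by (auto simp: f_def)
  qed
  moreover have "continuous_on Y f"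
  proof (rule continuous_on_of_modulus)
    have "(w \<longlongrightarrow> max 0 0) (at_right 0)" unfolding w_def
      using assms(7,11,13,16) by (intro tendsto_max powr_tendsto_0_at_right varpi_tendsto_0)
    then show "(w \<longlongrightarrow> 0) (at_right 0)" by simp
    show "dist (f x) (f y) \<le> (max 0 Cg + CA) * w (dist x y)" if "x \<in> Y" "y \<in> Y" "x \<noteq> y" for x y
      using mod_f[OF that] by (simp add: dist_norm)
  qed
  moreover have "cmod (f x - f y) / w (dist x y) \<le> max 0 Cg + CA" if "x \<in> Y" "y \<in> Y" "x \<noteq> y" for x y
  proof -
    \<comment> \<open>Positivity comes from \<open>r powr \<theta>\<close> alone and makes the
      quotient form of the modulus equivalent to the product form.\<close>
    have "0 < w (dist x y)" using that by (simp add: w_def less_max_iff_disj)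
    then show ?thesis using mod_f[OF that] by (simp add: divide_le_eq)
  qed
  ultimately have "holder_space (\<lambda>r. max (r powr \<theta>) (varpi ups s1 s2 s3 r)) Y f"
    unfolding holder_space_def w_def by blast
  moreover have "AE x in nu. \<mu> x = f x"
    using \<open>AE x in nu. \<mu> x - layer_op nu K \<mu> x = g x\<close>
    by eventually_elim (simp add: f_def algebra_simps)
  ultimately show ?thesis by blast
qed


end
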